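(* Let $\alpha=(\alpha_1,\ldots,\alpha_k)$ be a composition of $m\le n$ with $k$ parts, and let $p$ be a positive integer with $p\le n$. Then $$\sigma^{\alpha}(n,p)=\frac{(n-m)!\prod_{i=1}^k\alpha_i!}{c(n,p)}\sum_{r=0}^{n-m}\binom{1-k}{r}\binom{n+k-1}{n-m-r}\frac{c(n-k-r+1,p)}{(n-k-r+1)!}.$$
   Context: $c(n,p)$ denotes the signless Stirling number of the first kind, i.e. the number of permutations of $[n]=\{1,\ldots,n\}$ with exactly $p$ cycles. $\binom{x}{r}=x(x-1)\cdots(x-r+1)/r!$ for any integer $x$. For a composition $\alpha=(\alpha_1,\ldots,\alpha_k)$ of $m\le n$, a tuple $A=(A_1,\ldots,A_k)$ of pairwise disjoint subsets of $[n]$ with $\#A_i=\alpha_i$ is fixed; a permutation is $A$-separated if no cycle of it contains elements of more than one of the sets $A_i$. $\sigma^{\alpha}(n,p)$ is the probability that the product of a uniformly random permutation of $[n]$ with exactly $p$ cycles and a uniformly random $n$-cycle is $A$-separated (this does not depend on the choice of $A$). *)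

theory Defs
  imports "HOL-Probability.Probability" "HOL-Combinatorics.Combinatorics"
begin

text \<open>Permutations of $[n]$ are functions on the naturals that permute \<open>{1..n}\<close>, hence are the
  identity elsewhere.  Fixed points count as cycles, with singleton orbits.\<close>

definition cycles_on :: "'a set \<Rightarrow> ('a \<Rightarrow> 'a) \<Rightarrow> 'a set set" where
  "cycles_on S w = orbit w ` S"

definition perms_with_cycles :: "nat \<Rightarrow> nat \<Rightarrow> (nat \<Rightarrow> nat) set" where
  "perms_with_cycles n p = {w. w permutes {1..n} \<and> card (cycles_on {1..n} w) = p}"

definition full_cycles :: "nat \<Rightarrow> (nat \<Rightarrow> nat) set" where
  "full_cycles n = {w. w permutes {1..n} \<and> cyclic_on w {1..n}}"

definition stirling_c :: "nat \<Rightarrow> nat \<Rightarrow> nat" where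
  "stirling_c n p = card (perms_with_cycles n p)"

definition is_composition :: "nat list \<Rightarrow> nat \<Rightarrow> bool" where
  "is_composition \<alpha> m \<longleftrightarrow> (\<forall>a \<in> set \<alpha>. 0 < a) \<and> sum_list \<alpha> = m"

definition disjoint_tuple :: "nat \<Rightarrow> nat list \<Rightarrow> nat set list \<Rightarrow> bool" where
  "disjoint_tuple n \<alpha> A \<longleftrightarrow>
     length A = length \<alpha> \<and>
     (\<forall>i < length A. A ! i \<subseteq> {1..n} \<and> card (A ! i) = \<alpha> ! i) \<and>
     (\<forall>i < length A. \<forall>j < length A. i \<noteq> j \<longrightarrow> A ! i \<inter> A ! j = {})"

definition separated :: "nat \<Rightarrow> nat set list \<Rightarrow> (nat \<Rightarrow> nat) \<Rightarrow> bool" where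
  "separated n A w \<longleftrightarrow>
     (\<forall>C \<in> cycles_on {1..n} w. \<forall>i < length A. \<forall>j < length A.
        C \<inter> A ! i \<noteq> {} \<and> C \<inter> A ! j \<noteq> {} \<longrightarrow> i = j)"

text \<open>The two random permutations are independent.  The result is meaningful only if
  \<open>1 \<le> p\<close> and \<open>p \<le> n\<close>, so that both sets of permutations are nonempty.
  The tuple \<open>A\<close> is a parameter here; that the probability depends only on the sizes
  of its members is part of any formula stated for all tuples \<open>A\<close> of a given type.\<close>

definition sep_prob :: "nat \<Rightarrow> nat \<Rightarrow> nat set list \<Rightarrow> real" where
  "sep_prob n p A =
     measure_pmf.prob (pair_pmf (pmf_of_set (perms_with_cycles n p)) (pmf_of_set (full_cycles n)))
       {(u, v). separated n A (u \<circ> v)}"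

end

theory Submission
  imports Defs
begin

unbundle no vec_syntax
unbundle fps_syntax

text \<open>For a permutation \<open>w\<close> of a set of \<open>n\<close> elements, let \<open>h w\<close> be the sum of \<open>y\<close> to the number
  of cycles of \<open>w v\<close> over all full cycles \<open>v\<close>.  Up to the factor \<open>(n - 1)!\<close>, it is the coefficient of
  degree \<open>n + 1\<close> in \<open>(1 - X)\<close> to the power \<open>- y\<close> times the product of
  \<open>1 - (1 - X)^j\<close> over the cycle lengths \<open>j\<close> of \<open>w\<close>.  This follows by removing one element at a
  time: \<open>h\<close> satisfies a cut-and-join recurrence, and so does the coefficient.

  Hence only the sum \<open>W\<close> of these products over all separated \<open>w\<close> is needed.  If the blocks exhaust
  the set, then \<open>W\<close> is a product over the blocks, and a block of size \<open>b\<close> contributes \<open>b! X\<close>.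
  Inserting an element outside the blocks in all possible ways turns \<open>W\<close> into
  \<open>(X + n) W + X (1 - X) W'\<close>, and this recurrence has the binomial sum of the theorem as its solution.
  Finally, the coefficients of \<open>(1 - X)\<close> to the power \<open>- y\<close> are rising factorials in \<open>y\<close> divided by
  factorials, that is, generating functions of Stirling numbers, and one compares the
  coefficients of \<open>y^p\<close>.\<close>

text \<open>The bare name \<open>transpose\<close> denotes the transpose of a matrix here.\<close>

abbreviation swp :: "'a \<Rightarrow> 'a \<Rightarrow> 'a \<Rightarrow> 'a" where
  "swp \<equiv> Transposition.transpose"

section \<open>Cycles of a permutation multiplied by a transposition\<close>

text \<open>The factor \<open>swp b c\<close> changes \<open>w\<close> only at \<open>b\<close> and
  \<open>c\<close>, and by symmetry of the orbit relation the cycle of \<open>x\<close> contains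
  neither.\<close>

lemma orbit_comp_transpose_other:
  assumes w: "permutation w" and x: "x \<notin> orbit w b" "x \<notin> orbit w c"
  shows "orbit (w \<circ> swp b c) x = orbit w x"
proof (rule orbit_cong)
  show self: "x \<in> orbit w x"
    by (rule permutation_self_in_orbit[OF w])
  show "(w \<circ> swp b c) s = w s" if "s \<in> orbit w x" for s
  proof -
    have "x \<in> orbit w s"
      using orbit_swap[OF self that] .
    then show ?thesis
      using x by (metis comp_apply transpose_apply_other)
  qed
qed

text \<open>From \<open>b\<close> the product steps to \<open>w c\<close> and then follows
  \<open>w\<close> along the cycle of \<open>c\<close>, which never meets \<open>b\<close>. The
  other half of the merged cycle is obtained by exchanging \<open>b\<close> and
  \<open>c\<close>.\<close>

lemma orbit_comp_transpose_merge_subset: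
  assumes bc: "b \<notin> orbit w c"
  shows "orbit w c \<subseteq> orbit (w \<circ> swp b c) b"
proof
  fix x assume "x \<in> orbit w c"
  then show "x \<in> orbit (w \<circ> swp b c) b"
  proof induction
    case base
    show ?case by (rule orbit_eqI(1)) simp
  next
    case (step y)
    show ?case
    proof (cases "y = c")
      \<comment> \<open>The product leaves \<open>c\<close> towards \<open>w b\<close>, but
        \<open>w c\<close> is the first point reached from \<open>b\<close>.\<close>
      case True
      show ?thesis unfolding True by (rule orbit_eqI(1)) simp
    next
      case False
      with step bc have "y \<noteq> b" "y \<noteq> c" by auto
      then show ?thesis by (intro orbit_eqI(2)[OF _ step.IH]) simp
    qed
  qed
qed

text \<open>The two cycles are concatenated: \<open>b\<close> is followed by \<open>w c\<close>, and
  \<open>c\<close> by \<open>w b\<close>.\<close>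

lemma orbit_comp_transpose_merge:
  assumes w: "permutation w" and bc: "b \<notin> orbit w c"
  shows "orbit (w \<circ> swp b c) b = orbit w b \<union> orbit w c"
    (is "orbit ?v b = _")
proof
  note self = permutation_self_in_orbit[OF w]
  have cb: "c \<notin> orbit w b"
    using bc orbit_swap[OF self] by metis
  show "orbit w b \<union> orbit w c \<subseteq> orbit ?v b"
  proof -
    have 1: "orbit w c \<subseteq> orbit ?v b"
      by (rule orbit_comp_transpose_merge_subset[OF bc])
    have 2: "orbit w b \<subseteq> orbit ?v c"
      using orbit_comp_transpose_merge_subset[OF cb] by (simp add: transpose_commute)
    have "c \<in> orbit ?v b" using 1 self by auto
    then have "orbit ?v c \<subseteq> orbit ?v b" by (auto intro: orbit_trans)
    then show ?thesis using 1 2 by auto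
  qed
  show "orbit ?v b \<subseteq> orbit w b \<union> orbit w c"
  proof
    fix x assume "x \<in> orbit ?v b"
    then show "x \<in> orbit w b \<union> orbit w c"
    proof induction
      case base
      show ?case by (simp add: orbit.base)
    next
      case (step y)
      have "w (swp b c y) \<in> orbit w b \<union> orbit w c"
        by (cases "y = b"; cases "y = c")
          (use step in \<open>auto simp: orbit.base intro: orbit.step\<close>)
      then show ?case by simp
    qed
  qed
qed

text \<open>Inversion preserves orbits and moves the transposition to the other side, so what is
  shown for \<open>w \<circ> swp b c\<close> carries over to
  \<open>swp b c \<circ> w\<close>.\<close>

lemma orbit_transpose_comp_eq:
  assumes "permutation w"
  shows "orbit (swp b c \<circ> w) x = orbit (inv w \<circ> swp b c) x"
proof -
  have t: "permutation (swp b c \<circ> w)"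
    using assms by (intro permutation_compose permutation_swap_id)
  have "inv (swp b c \<circ> w) = inv w \<circ> swp b c"
    using assms by (simp add: o_inv_distrib permutation_bijective bij_swap_iff)
  then show ?thesis
    using orbit_inv_eq[OF t, of x] by simp
qed

lemma orbit_transpose_comp_other:
  assumes "permutation w" "x \<notin> orbit w b" "x \<notin> orbit w c"
  shows "orbit (swp b c \<circ> w) x = orbit w x"
  using orbit_comp_transpose_other[of "inv w" x b c] assms
  by (simp add: orbit_transpose_comp_eq orbit_inv_eq permutation_inverse)

lemma orbit_transpose_comp_merge:
  assumes "permutation w" "b \<notin> orbit w c"
  shows "orbit (swp b c \<circ> w) b = orbit w b \<union> orbit w c"
  using orbit_comp_transpose_merge[of "inv w" b c] assms
  by (simp add: orbit_transpose_comp_eq orbit_inv_eq permutation_inverse)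

lemma orbit_eq_of_mem:
  assumes "permutation w" "y \<in> orbit w x"
  shows "orbit w y = orbit w x"
  using cyclic_on_orbit'[OF assms(1), of x] assms(2) orbit_cyclic_eq3 by metis

text \<open>Index \<open>0\<close> of the usual parametrization of a cycle is replaced by
  \<open>s\<close>, which gives the same point \<open>b\<close>. Thus a cut of the cycle corresponds
  to a cut of \<open>{1..s}\<close> into two consecutive ranges.\<close>

lemma orbit_funpow_range:
  fixes w :: "'a \<Rightarrow> 'a" and b :: 'a
  assumes "permutation w"
  defines "s \<equiv> card (orbit w b)"
  shows "(w ^^ s) b = b" and "inj_on (\<lambda>j. (w ^^ j) b) {1..s}"
    and "orbit w b = (\<lambda>j. (w ^^ j) b) ` {1..s}" and "0 < s"
proof -
  note self = permutation_self_in_orbit[OF assms(1), of b]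
  define d where "d = funpow_dist1 w b b"
  have im: "orbit w b = (\<lambda>n. (w ^^ n) b) ` {0..<d}"
    unfolding d_def by (rule orbit_conv_funpow_dist1[OF self])
  have inj: "inj_on (\<lambda>n. (w ^^ n) b) {0..<d}"
    unfolding d_def by (rule inj_on_funpow_dist1[OF self])
  have sd: "s = d"
    unfolding s_def im using card_image[OF inj] by simp
  have d0: "0 < d" unfolding d_def by simp
  show s0: "0 < s" using d0 sd by simp
  have per: "(w ^^ d) b = b"
    unfolding d_def by (rule funpow_dist1_prop[OF self])
  then show "(w ^^ s) b = b" using sd by simp
  have eq: "(\<lambda>j. (w ^^ j) b) ` {1..s} = (\<lambda>j. (w ^^ j) b) ` {0..<d}"
  proof -
    have "{1..s} = insert d {1..<d}" "{0..<d} = insert 0 {1..<d}"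
      using d0 sd by auto
    then show ?thesis using per by simp
  qed
  then show "orbit w b = (\<lambda>j. (w ^^ j) b) ` {1..s}" using im by simp
  show "inj_on (\<lambda>j. (w ^^ j) b) {1..s}"
    by (rule eq_card_imp_inj_on) (use eq im s_def in auto)
qed

text \<open>Let \<open>p j = (w ^^ j) b\<close>, and let \<open>s\<close> be the length of the
  cycle. The product sends \<open>c = p i\<close> to \<open>p 1\<close> and \<open>b = p s\<close>
  to \<open>p (i + 1)\<close>, and moves all other points of the cycle as \<open>w\<close>
  does.\<close>

lemma orbit_comp_transpose_split:
  fixes w :: "'a \<Rightarrow> 'a" and b :: 'a
  assumes w: "permutation w" and i: "0 < i" "i < card (orbit w b)"
  defines "c \<equiv> (w ^^ i) b"
  shows "orbit (w \<circ> swp b c) c = (\<lambda>j. (w ^^ j) b) ` {1..i}"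
    and "orbit (w \<circ> swp b c) b = (\<lambda>j. (w ^^ j) b) ` {i+1..card (orbit w b)}"
proof -
  define s where "s = card (orbit w b)"
  note per = orbit_funpow_range[OF w, of b, folded s_def]
  let ?p = "\<lambda>j. (w ^^ j) b" and ?v = "w \<circ> swp b c"
  have i_s: "i < s" using i s_def by simp
  have pb: "?p j = b \<longleftrightarrow> j = s" if "j \<in> {1..s}" for j
    using inj_onD[OF per(2), of j s] per(1,4) that by auto
  have pc: "?p j = c \<longleftrightarrow> j = i" if "j \<in> {1..s}" for j
    using inj_onD[OF per(2), of j i] i_s i that unfolding c_def by auto
  have v: "?v (?p j) = ?p (Suc j)" if "j \<in> {1..s}" "j \<noteq> i" "j \<noteq> s" for j
    using pb[OF that(1)] pc[OF that(1)] that by simp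
  have vc: "?v c = ?p 1" by simp
  have vb: "?v b = ?p (Suc i)" by (simp add: c_def)
  show "orbit ?v c = ?p ` {1..i}"
  proof
    show "orbit ?v c \<subseteq> ?p ` {1..i}"
    proof
      fix x assume "x \<in> orbit ?v c"
      then show "x \<in> ?p ` {1..i}"
      proof induction
        case base
        show ?case unfolding vc using i by (intro imageI) auto
      next
        case (step y)
        then obtain j where j: "y = ?p j" "j \<in> {1..i}" by auto
        show ?case
        proof (cases "j = i")
          case True
          then have "y = c" using j by (simp add: c_def)
          then have "?v y = ?p 1" using vc by simp
          then show ?thesis using i by (auto simp del: funpow.simps)
        next
          case False
          then have "?v y = ?p (Suc j)" using v[of j] j i_s by auto
          then show ?thesis using j False by (auto simp del: funpow.simps)
        qed
      qed
    qed
    have "?p j \<in> orbit ?v c" if "1 \<le> j" "j \<le> i" for j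
      using that
    proof (induction j rule: dec_induct)
      case base
      show ?case using orbit.base[of ?v c] unfolding vc .
    next
      case (step j)
      have "?p j \<in> orbit ?v c"
        by (rule step.IH) (use step.hyps step.prems i_s in auto)
      moreover have "?v (?p j) = ?p (Suc j)"
        by (rule v) (use step.hyps step.prems i_s in auto)
      ultimately show ?case by (metis orbit.step)
    qed
    then show "?p ` {1..i} \<subseteq> orbit ?v c" by auto
  qed
  show "orbit ?v b = ?p ` {i+1..card (orbit w b)}" unfolding s_def[symmetric]
  proof
    show "orbit ?v b \<subseteq> ?p ` {i+1..s}"
    proof
      fix x assume "x \<in> orbit ?v b"
      then show "x \<in> ?p ` {i+1..s}"
      proof induction
        case base
        show ?case unfolding vb using i_s by (intro imageI) auto
      next
        case (step y)
        then obtain j where j: "y = ?p j" "j \<in> {i+1..s}" by auto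
        show ?case
        proof (cases "j = s")
          case True
          then have "y = b" using j per(1) by simp
          then have "?v y = ?p (Suc i)" using vb by simp
          then show ?thesis using i_s by (auto simp del: funpow.simps)
        next
          case False
          then have "?v y = ?p (Suc j)" using v[of j] j i by auto
          then show ?thesis using j False by (auto simp del: funpow.simps)
        qed
      qed
    qed
    have "?p j \<in> orbit ?v b" if "Suc i \<le> j" "j \<le> s" for j
      using that
    proof (induction j rule: dec_induct)
      case base
      show ?case using orbit.base[of ?v b] unfolding vb .
    next
      case (step j)
      have "?p j \<in> orbit ?v b"
        by (rule step.IH) (use step.hyps step.prems in auto)
      moreover have "?v (?p j) = ?p (Suc j)"
        by (rule v) (use step.hyps step.prems in auto)
      ultimately show ?case by (metis orbit.step)
    qed
    then show "?p ` {i+1..s} \<subseteq> orbit ?v b" by auto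
  qed
qed

text \<open>Obtained by cutting the cycle of \<open>inv w\<close>, which is why \<open>c\<close> is
  reached by powers of the inverse.\<close>

lemma orbit_transpose_comp_split:
  fixes w :: "'a \<Rightarrow> 'a" and b :: 'a
  assumes w: "permutation w" and i: "0 < i" "i < card (orbit w b)"
  defines "c \<equiv> (inv w ^^ i) b" and "v \<equiv> swp b ((inv w ^^ i) b) \<circ> w"
  shows "card (orbit v c) = i" and "card (orbit v b) = card (orbit w b) - i"
    and "orbit v c \<union> orbit v b = orbit w b" and "orbit v c \<inter> orbit v b = {}"
proof -
  define s where "s = card (orbit w b)"
  let ?p = "\<lambda>j. (inv w ^^ j) b"
  have w': "permutation (inv w)" using w by (rule permutation_inverse)
  have s': "s = card (orbit (inv w) b)" by (simp add: s_def orbit_inv_eq w)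
  note per = orbit_funpow_range[OF w', of b, folded s']
  have oc: "orbit v c = ?p ` {1..i}" and ob: "orbit v b = ?p ` {i+1..s}"
    using orbit_comp_transpose_split[OF w' i(1), of b] i(2)
    unfolding v_def c_def orbit_transpose_comp_eq[OF w] s_def by (simp_all add: orbit_inv_eq w)
  have i_s: "i < s" using i s_def by simp
  show "card (orbit v c) = i"
    unfolding oc by (subst card_image) (use inj_on_subset[OF per(2)] i_s in auto)
  show "card (orbit v b) = card (orbit w b) - i"
    unfolding ob s_def[symmetric]
    by (subst card_image) (use inj_on_subset[OF per(2)] i_s in auto)
  have "orbit w b = ?p ` {1..s}" using per(3) by (simp add: orbit_inv_eq w)
  moreover have "{1..s} = {1..i} \<union> {i+1..s}" using i_s by auto
  ultimately show "orbit v c \<union> orbit v b = orbit w b" unfolding oc ob by (simp add: image_Un)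
  show "orbit v c \<inter> orbit v b = {}"
    unfolding oc ob using inj_on_image_Int[OF per(2), of "{1..i}" "{i+1..s}"] i_s by auto
qed

section \<open>Cycles as a partition of the underlying set\<close>

lemma finite_cycles_on: "finite S \<Longrightarrow> finite (cycles_on S w)"
  by (simp add: cycles_on_def)

lemma permutes_permutation: "finite S \<Longrightarrow> w permutes S \<Longrightarrow> permutation w"
  by (auto simp: permutation_permutes)

lemma cycles_on_mem_cases:
  assumes "finite S" "w permutes S" "C \<in> cycles_on S w" "x \<in> C"
  shows "C = orbit w x" "x \<in> S"
proof -
  obtain y where y: "y \<in> S" "C = orbit w y" using assms(3) by (auto simp: cycles_on_def)
  show "C = orbit w x"
    using orbit_eq_of_mem[OF permutes_permutation[OF assms(1,2)]] assms(4) y by simp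
  show "x \<in> S" using permutes_orbit_subset[OF assms(2) y(1)] assms(4) y(2) by auto
qed

text \<open>Used to read off the cycles of a product: the points of a candidate family are tested
  one by one.\<close>

lemma cycles_on_eqI:
  assumes "finite S" "w permutes S"
    and "\<And>C. C \<in> K \<Longrightarrow> C \<noteq> {}"
    and "\<And>C x. C \<in> K \<Longrightarrow> x \<in> C \<Longrightarrow> x \<in> S \<and> orbit w x = C"
    and "S \<subseteq> \<Union>K"
  shows "cycles_on S w = K"
proof
  show "cycles_on S w \<subseteq> K"
    using assms(4,5) unfolding cycles_on_def by fastforce
  show "K \<subseteq> cycles_on S w"
    using assms(3,4) unfolding cycles_on_def by fastforce
qed

lemma cycles_on_Union:
  assumes "finite S" "w permutes S"
  shows "\<Union>(cycles_on S w) = S"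
  using permutes_orbit_subset[OF assms(2)]
    permutation_self_in_orbit[OF permutes_permutation[OF assms]]
  unfolding cycles_on_def by blast

lemma cycles_on_disjoint:
  assumes "finite S" "w permutes S" "C \<in> cycles_on S w" "D \<in> cycles_on S w" "C \<noteq> D"
  shows "C \<inter> D = {}"
  using cycles_on_mem_cases(1)[OF assms(1,2,3)] cycles_on_mem_cases(1)[OF assms(1,2,4)] assms(5)
  by (metis disjoint_iff)

lemma transpose_comp_permutes:
  assumes "w permutes S" "b \<in> S" "c \<in> S"
  shows "swp b c \<circ> w permutes S"
  using assms by (intro permutes_compose permutes_swap_id)

lemma cycles_on_transpose_merge:
  assumes S: "finite S" "w permutes S" and bc: "b \<in> S" "c \<in> S" "orbit w b \<noteq> orbit w c"
  shows "cycles_on S (swp b c \<circ> w) =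
    insert (orbit w b \<union> orbit w c) (cycles_on S w - {orbit w b, orbit w c})"
proof (rule cycles_on_eqI)
  have w: "permutation w" by (rule permutes_permutation[OF S])
  let ?v = "swp b c \<circ> w"
  show v: "?v permutes S" by (rule transpose_comp_permutes[OF S(2) bc(1,2)])
  have v': "permutation ?v" by (rule permutes_permutation[OF S(1) v])
  have "b \<notin> orbit w c" using orbit_eq_of_mem[OF w] bc(3) by metis
  then have ob: "orbit ?v b = orbit w b \<union> orbit w c"
    by (rule orbit_transpose_comp_merge[OF w])
  show "C \<noteq> {}"
    if "C \<in> insert (orbit w b \<union> orbit w c) (cycles_on S w - {orbit w b, orbit w c})" for C
    using that orbit_nonempty[of w] by (auto simp: cycles_on_def)
  show "S \<subseteq> \<Union> (insert (orbit w b \<union> orbit w c) (cycles_on S w - {orbit w b, orbit w c}))"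
    using cycles_on_Union[OF S] by blast
  show "x \<in> S \<and> orbit ?v x = C"
    if C: "C \<in> insert (orbit w b \<union> orbit w c) (cycles_on S w - {orbit w b, orbit w c})"
      and x: "x \<in> C" for C x
  proof (cases "C = orbit w b \<union> orbit w c")
    case True
    then show ?thesis
      using ob x orbit_eq_of_mem[OF v', of x b] permutes_orbit_subset[OF v bc(1)] by auto
  next
    case False
    then have C': "C \<in> cycles_on S w" "C \<noteq> orbit w b" "C \<noteq> orbit w c" using C by auto
    have xC: "C = orbit w x" "x \<in> S" using cycles_on_mem_cases[OF S C'(1) x] by auto
    have "x \<notin> orbit w b" "x \<notin> orbit w c" using C' xC orbit_eq_of_mem[OF w] by metis+
    then show ?thesis using orbit_transpose_comp_other[OF w] xC by simp
  qed
qed (fact S)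

lemma cycles_on_transpose_split:
  fixes w :: "'a \<Rightarrow> 'a" and b :: 'a
  assumes S: "finite S" "w permutes S" and b: "b \<in> S" and i: "0 < i" "i < card (orbit w b)"
  defines "v \<equiv> swp b ((inv w ^^ i) b) \<circ> w"
  shows "cycles_on S v = {orbit v ((inv w ^^ i) b), orbit v b} \<union> (cycles_on S w - {orbit w b})"
proof (rule cycles_on_eqI)
  have w: "permutation w" by (rule permutes_permutation[OF S])
  let ?c = "(inv w ^^ i) b"
  have c_in: "?c \<in> orbit w b"
    using funpow_in_orbit[of b "inv w" b i]
      permutation_self_in_orbit[OF permutation_inverse[OF w]] by (simp add: orbit_inv_eq w)
  then have c: "?c \<in> S" using permutes_orbit_subset[OF S(2) b] by auto
  show v: "v permutes S" unfolding v_def by (rule transpose_comp_permutes[OF S(2) b c])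
  have v': "permutation v" by (rule permutes_permutation[OF S(1) v])
  have oc: "orbit w ?c = orbit w b" by (rule orbit_eq_of_mem[OF w c_in])
  note split = orbit_transpose_comp_split[OF w i, folded v_def]
  let ?K = "{orbit v ?c, orbit v b} \<union> (cycles_on S w - {orbit w b})"
  show "C \<noteq> {}" if "C \<in> ?K" for C
    using that orbit_nonempty[of w] orbit_nonempty[of v] by (auto simp: cycles_on_def)
  show "S \<subseteq> \<Union>?K"
    using cycles_on_Union[OF S] split(3) by blast
  show "x \<in> S \<and> orbit v x = C" if C: "C \<in> ?K" and x: "x \<in> C" for C x
  proof (cases "C \<in> {orbit v ?c, orbit v b}")
    case True
    then show ?thesis
      using x orbit_eq_of_mem[OF v', of x] permutes_orbit_subset[OF v c]
        permutes_orbit_subset[OF v b] by auto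
  next
    case False
    then have C': "C \<in> cycles_on S w" "C \<noteq> orbit w b" using C by auto
    have xC: "C = orbit w x" "x \<in> S" using cycles_on_mem_cases[OF S C'(1) x] by auto
    have "x \<notin> orbit w b" using C' xC orbit_eq_of_mem[OF w] by metis
    then have "orbit v x = orbit w x"
      unfolding v_def using oc by (intro orbit_transpose_comp_other[OF w]) auto
    then show ?thesis using xC by simp
  qed
qed (fact S)

lemma cycles_on_insert_fixed:
  assumes "finite S" "w permutes S" "a \<notin> S"
  shows "cycles_on (insert a S) w = insert {a} (cycles_on S w)"
proof -
  have "w a = a" using assms by (simp add: permutes_not_in)
  then have "orbit w a = {a}" by (simp add: orbit_eq_singleton_iff)
  then show ?thesis by (simp add: cycles_on_def)
qed

text \<open>Since \<open>w\<close> fixes \<open>a\<close>, this is the merging of the cycle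
  \<open>{a}\<close> with the cycle of \<open>b\<close>.\<close>

lemma cycles_on_insert:
  assumes S: "finite S" "w permutes S" and a: "a \<notin> S" and b: "b \<in> S"
  shows "cycles_on (insert a S) (swp a b \<circ> w) =
    insert (insert a (orbit w b)) (cycles_on S w - {orbit w b})"
proof -
  have "w a = a" using assms by (simp add: permutes_not_in)
  then have oa: "orbit w a = {a}" by (simp add: orbit_eq_singleton_iff)
  have sub: "orbit w b \<subseteq> S" by (rule permutes_orbit_subset[OF S(2) b])
  have ne: "orbit w a \<noteq> orbit w b"
    using sub a oa by auto
  have a': "{a} \<notin> cycles_on S w"
    using cycles_on_Union[OF S] a by auto
  have "w permutes insert a S" by (rule permutes_subset[OF S(2)]) auto
  then have "cycles_on (insert a S) (swp a b \<circ> w) =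
      insert (orbit w a \<union> orbit w b) (cycles_on (insert a S) w - {orbit w a, orbit w b})"
    using S b ne by (intro cycles_on_transpose_merge) auto
  also have "\<dots> = insert (insert a (orbit w b)) (cycles_on S w - {orbit w b})"
    using a' unfolding oa cycles_on_insert_fixed[OF S a] by auto
  finally show ?thesis .
qed

section \<open>Multiplicative cycle weights\<close>

text \<open>A constant weight \<open>y\<close> gives \<open>y\<close> to the number of cycles; the
  weight \<open>cycle_fps\<close> gives the product of power series in the coefficient formula. One
  set of rules serves both.\<close>

definition cycle_weight :: "(nat \<Rightarrow> 'b::comm_monoid_mult) \<Rightarrow> 'a set \<Rightarrow> ('a \<Rightarrow> 'a) \<Rightarrow> 'b" where
  "cycle_weight \<phi> S w = (\<Prod>C\<in>cycles_on S w. \<phi> (card C))"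

lemma cycle_weight_remove:
  assumes "finite S" "b \<in> S"
  shows "cycle_weight \<phi> S w =
    \<phi> (card (orbit w b)) * (\<Prod>C\<in>cycles_on S w - {orbit w b}. \<phi> (card C))"
  unfolding cycle_weight_def
  by (rule prod.remove[OF finite_cycles_on[OF assms(1)]]) (simp add: cycles_on_def assms)

lemma cycle_weight_insert_fixed:
  assumes "finite S" "w permutes S" "a \<notin> S"
  shows "cycle_weight \<phi> (insert a S) w = \<phi> 1 * cycle_weight \<phi> S w"
proof -
  have "{a} \<notin> cycles_on S w" using cycles_on_Union[OF assms(1,2)] assms(3) by auto
  then show ?thesis
    unfolding cycle_weight_def cycles_on_insert_fixed[OF assms]
    by (simp add: finite_cycles_on assms)
qed

lemma cycle_weight_insert:
  assumes S: "finite S" "w permutes S" and a: "a \<notin> S" and b: "b \<in> S"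
  shows "cycle_weight \<phi> (insert a S) (swp a b \<circ> w) =
    \<phi> (card (orbit w b) + 1) * (\<Prod>C\<in>cycles_on S w - {orbit w b}. \<phi> (card C))"
proof -
  have "insert a (orbit w b) \<notin> cycles_on S w - {orbit w b}"
    using cycles_on_Union[OF S] a by auto
  moreover have "a \<notin> orbit w b" "finite (orbit w b)"
    using permutes_orbit_subset[OF S(2) b] a S(1) finite_subset by auto
  ultimately show ?thesis
    unfolding cycle_weight_def cycles_on_insert[OF S a b]
    by (simp add: finite_cycles_on S)
qed

lemma cycle_weight_const_insert:
  assumes "finite S" "w permutes S" "a \<notin> S" "b \<in> S"
  shows "cycle_weight (\<lambda>_. y) (insert a S) (swp a b \<circ> w) = cycle_weight (\<lambda>_. y) S w"
  using cycle_weight_insert[OF assms, of "\<lambda>_. y"] cycle_weight_remove[OF assms(1,4), of "\<lambda>_. y"]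
  by simp

lemma cycle_weight_merge:
  assumes S: "finite S" "w permutes S" and bc: "b \<in> S" "c \<in> S" "orbit w b \<noteq> orbit w c"
  shows "cycle_weight \<phi> S (swp b c \<circ> w) =
    \<phi> (card (orbit w b) + card (orbit w c)) *
    (\<Prod>C\<in>cycles_on S w - {orbit w b, orbit w c}. \<phi> (card C))"
proof -
  have mem: "orbit w b \<in> cycles_on S w" "orbit w c \<in> cycles_on S w"
    using bc by (auto simp: cycles_on_def)
  have disj: "orbit w b \<inter> orbit w c = {}"
    by (rule cycles_on_disjoint[OF S mem bc(3)])
  have fin: "finite (orbit w b)" "finite (orbit w c)"
    using permutes_orbit_subset[OF S(2)] bc S(1) finite_subset by metis+
  have "orbit w b \<union> orbit w c \<notin> cycles_on S w - {orbit w b, orbit w c}"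
    using cycles_on_disjoint[OF S mem(1)] orbit_nonempty[of w b] by blast
  then show ?thesis
    unfolding cycle_weight_def cycles_on_transpose_merge[OF S bc]
    by (simp add: finite_cycles_on S card_Un_disjoint fin disj)
qed

lemma cycle_weight_split:
  assumes S: "finite S" "w permutes S" and b: "b \<in> S" and i: "0 < i" "i < card (orbit w b)"
  shows "cycle_weight \<phi> S (swp b ((inv w ^^ i) b) \<circ> w) =
    \<phi> i * \<phi> (card (orbit w b) - i) * (\<Prod>C\<in>cycles_on S w - {orbit w b}. \<phi> (card C))"
proof -
  have w: "permutation w" by (rule permutes_permutation[OF S])
  let ?c = "(inv w ^^ i) b"
  let ?v = "swp b ?c \<circ> w"
  note split = orbit_transpose_comp_split[OF w i]
  have ne: "orbit ?v ?c \<noteq> orbit ?v b"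
    using split(4) orbit_nonempty[of ?v b] by auto
  have mem: "orbit w b \<in> cycles_on S w" using b by (auto simp: cycles_on_def)
  have new: "C \<notin> cycles_on S w - {orbit w b}" if "C \<noteq> {}" "C \<subseteq> orbit w b" for C
    using cycles_on_disjoint[OF S mem] that by blast
  have "orbit ?v ?c \<notin> cycles_on S w - {orbit w b}" "orbit ?v b \<notin> cycles_on S w - {orbit w b}"
    by (rule new[OF orbit_nonempty], use split(3) in blast)+
  then show ?thesis
    unfolding cycle_weight_def cycles_on_transpose_split[OF S b i]
    using ne by (simp add: finite_cycles_on S split(1,2) mult.assoc del: comp_apply)
qed

lemma sum_over_cycles:
  fixes f :: "'a \<Rightarrow> 'b::comm_monoid_add"
  assumes S: "finite S" "w permutes S" and K: "K \<subseteq> cycles_on S w"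
  shows "(\<Sum>x\<in>\<Union>K. f x) = (\<Sum>C\<in>K. \<Sum>x\<in>C. f x)"
proof -
  have "finite C" if "C \<in> K" for C
    using that K cycles_on_Union[OF S] S(1) by (metis Union_upper finite_subset subsetD)
  then have "(\<Sum>x\<in>\<Union>K. f x) = (sum \<circ> sum) f K"
    using cycles_on_disjoint[OF S] K by (intro sum.Union_disjoint) auto
  then show ?thesis by simp
qed

text \<open>Each of the \<open>card C\<close> elements \<open>b\<close> of a cycle \<open>C\<close>
  enlarges \<open>C\<close> by one and leaves the other cycles unchanged.\<close>

lemma sum_cycle_weight_insert:
  fixes \<phi> :: "nat \<Rightarrow> 'b::comm_semiring_1"
  assumes S: "finite S" "w permutes S" and a: "a \<notin> S"
  shows "(\<Sum>b\<in>S. cycle_weight \<phi> (insert a S) (swp a b \<circ> w)) =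
    (\<Sum>C\<in>cycles_on S w. of_nat (card C) * \<phi> (card C + 1) *
      (\<Prod>D\<in>cycles_on S w - {C}. \<phi> (card D)))"
proof -
  have "(\<Sum>b\<in>S. cycle_weight \<phi> (insert a S) (swp a b \<circ> w)) =
      (\<Sum>C\<in>cycles_on S w. \<Sum>b\<in>C. cycle_weight \<phi> (insert a S) (swp a b \<circ> w))"
    using sum_over_cycles[OF S order.refl] unfolding cycles_on_Union[OF S] .
  also have "\<dots> = (\<Sum>C\<in>cycles_on S w. of_nat (card C) * \<phi> (card C + 1) *
      (\<Prod>D\<in>cycles_on S w - {C}. \<phi> (card D)))"
  proof (rule sum.cong[OF refl])
    fix C assume C: "C \<in> cycles_on S w"
    have "cycle_weight \<phi> (insert a S) (swp a b \<circ> w) =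
        \<phi> (card C + 1) * (\<Prod>D\<in>cycles_on S w - {C}. \<phi> (card D))" if "b \<in> C" for b
      using cycle_weight_insert[OF S a] cycles_on_mem_cases[OF S C that] by metis
    then show "(\<Sum>b\<in>C. cycle_weight \<phi> (insert a S) (swp a b \<circ> w)) = of_nat (card C) *
        \<phi> (card C + 1) * (\<Prod>D\<in>cycles_on S w - {C}. \<phi> (card D))"
      by (simp add: mult.assoc)
  qed
  finally show ?thesis .
qed

text \<open>The cut-and-join rule. A point \<open>c\<close> in the cycle of \<open>b\<close> cuts
  it, and each size \<open>i\<close> occurs once; a point of another cycle \<open>C\<close> joins
  the two cycles, and there are \<open>card C\<close> such points.\<close>

lemma sum_cycle_weight_transpose:
  fixes \<phi> :: "nat \<Rightarrow> 'b::comm_semiring_1"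
  assumes S: "finite S" "w permutes S" and b: "b \<in> S"
  defines "B \<equiv> orbit w b" and "K \<equiv> cycles_on S w"
  shows "(\<Sum>c\<in>S - {b}. cycle_weight \<phi> S (swp b c \<circ> w)) =
    (\<Sum>i\<in>{1..<card B}. \<phi> i * \<phi> (card B - i)) * (\<Prod>D\<in>K - {B}. \<phi> (card D)) +
    (\<Sum>C\<in>K - {B}. of_nat (card C) * \<phi> (card B + card C) * (\<Prod>D\<in>K - {B} - {C}. \<phi> (card D)))"
proof -
  let ?f = "\<lambda>c. cycle_weight \<phi> S (swp b c \<circ> w)"
  have w: "permutation w" by (rule permutes_permutation[OF S])
  have BK: "B \<in> K" using b by (auto simp: B_def K_def cycles_on_def)
  have bB: "b \<in> B" unfolding B_def by (rule permutation_self_in_orbit[OF w])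
  have disj: "C \<inter> B = {}" if "C \<in> K - {B}" for C
    using cycles_on_disjoint[OF S _ BK[unfolded K_def]] that unfolding K_def by auto
  have fin: "finite B"
    using permutes_orbit_subset[OF S(2) b] S(1) finite_subset unfolding B_def by metis
  have finU: "finite (\<Union>(K - {B}))"
    using cycles_on_Union[OF S] S(1) by (metis K_def Diff_subset Union_mono finite_subset)
  have "S - {b} = (B - {b}) \<union> \<Union>(K - {B})"
    using cycles_on_Union[OF S] BK bB disj unfolding K_def by blast
  moreover have "(B - {b}) \<inter> \<Union>(K - {B}) = {}" using disj by blast
  ultimately have "(\<Sum>c\<in>S - {b}. ?f c) = (\<Sum>c\<in>B - {b}. ?f c) + (\<Sum>c\<in>\<Union>(K - {B}). ?f c)"
    using fin finU by (simp add: sum.union_disjoint)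
  moreover have "(\<Sum>c\<in>B - {b}. ?f c) =
      (\<Sum>i\<in>{1..<card B}. \<phi> i * \<phi> (card B - i)) * (\<Prod>D\<in>K - {B}. \<phi> (card D))"
  proof -
    have w': "permutation (inv w)" using w by (rule permutation_inverse)
    have Beq: "orbit (inv w) b = B" by (simp add: B_def orbit_inv_eq w)
    note per = orbit_funpow_range[OF w', of b, unfolded Beq]
    let ?p = "\<lambda>j. (inv w ^^ j) b"
    \<comment> \<open>The power \<open>card B\<close> gives \<open>b\<close> itself, so the
      remaining indices run through \<open>B - {b}\<close> without repetition.\<close>
    have "B = ?p ` {1..card B}" by (fact per(3))
    also have "{1..card B} = insert (card B) {1..<card B}" using per(4) by auto
    also have "?p ` insert (card B) {1..<card B} = insert b (?p ` {1..<card B})"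
      by (simp add: per(1))
    finally have "B = insert b (?p ` {1..<card B})" .
    moreover have "b \<notin> ?p ` {1..<card B}"
    proof
      assume "b \<in> ?p ` {1..<card B}"
      then obtain j where j: "j \<in> {1..<card B}" "?p j = ?p (card B)" using per(1) by auto
      then show False using inj_onD[OF per(2) j(2)] per(4) by auto
    qed
    ultimately have "B - {b} = ?p ` {1..<card B}" by blast
    moreover have "inj_on ?p {1..<card B}" by (rule inj_on_subset[OF per(2)]) auto
    ultimately have "(\<Sum>c\<in>B - {b}. ?f c) = (\<Sum>i\<in>{1..<card B}. ?f (?p i))"
      by (simp add: sum.reindex)
    also have "\<dots> = (\<Sum>i\<in>{1..<card B}. \<phi> i * \<phi> (card B - i) * (\<Prod>D\<in>K - {B}. \<phi> (card D)))"
      unfolding B_def K_def by (intro sum.cong refl cycle_weight_split[OF S b]) auto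
    finally show ?thesis by (simp add: sum_distrib_right)
  qed
  moreover have "(\<Sum>c\<in>\<Union>(K - {B}). ?f c) =
      (\<Sum>C\<in>K - {B}. of_nat (card C) * \<phi> (card B + card C) * (\<Prod>D\<in>K - {B} - {C}. \<phi> (card D)))"
  proof -
    have "(\<Sum>c\<in>\<Union>(K - {B}). ?f c) = (\<Sum>C\<in>K - {B}. \<Sum>c\<in>C. ?f c)"
      by (rule sum_over_cycles[OF S]) (auto simp: K_def)
    also have "\<dots> = (\<Sum>C\<in>K - {B}. of_nat (card C) * \<phi> (card B + card C) *
        (\<Prod>D\<in>K - {B} - {C}. \<phi> (card D)))"
    proof (rule sum.cong[OF refl])
      fix C assume C: "C \<in> K - {B}"
      have "?f c = \<phi> (card B + card C) * (\<Prod>D\<in>K - {B} - {C}. \<phi> (card D))" if "c \<in> C" for c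
      proof -
        have c: "C = orbit w c" "c \<in> S"
          using cycles_on_mem_cases[OF S _ that] C by (auto simp: K_def)
        have K': "K - {B} - {C} = K - {B, C}" by auto
        have "orbit w b \<noteq> orbit w c" using C c(1) unfolding B_def by blast
        from cycle_weight_merge[OF S b c(2) this, of \<phi>] show ?thesis
          unfolding K' unfolding B_def K_def c(1)[symmetric] .
      qed
      then show "(\<Sum>c\<in>C. ?f c) =
          of_nat (card C) * \<phi> (card B + card C) * (\<Prod>D\<in>K - {B} - {C}. \<phi> (card D))"
        by (simp add: mult.assoc)
    qed
    finally show ?thesis .
  qed
  ultimately show ?thesis by (simp only:)
qed

section \<open>Products with full cycles\<close>

text \<open>The set \<open>full_cycles\<close> for an arbitrary ground set, so that elements can be
  removed by induction.\<close>

definition full_cycles_on :: "'a set \<Rightarrow> ('a \<Rightarrow> 'a) set" where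
  "full_cycles_on S = {v. v permutes S \<and> cyclic_on v S}"

lemma cyclic_on_iff_cycles_on:
  assumes "finite S" "S \<noteq> {}" "v permutes S"
  shows "cyclic_on v S \<longleftrightarrow> cycles_on S v = {S}"
  using assms(2) unfolding cyclic_on_alldef cycles_on_def by auto

lemma finite_full_cycles_on: "finite S \<Longrightarrow> finite (full_cycles_on S)"
  unfolding full_cycles_on_def using finite_permutations[of S] by (auto elim: rev_finite_subset)

text \<open>Inserting \<open>a\<close> into the cycle of \<open>c\<close> enlarges this cycle and
  leaves the others alone, so the number of cycles stays the same.\<close>

lemma cyclic_on_insert_iff:
  assumes S: "finite S" "S \<noteq> {}" "v permutes S" and a: "a \<notin> S" and c: "c \<in> S"
  shows "cyclic_on (swp a c \<circ> v) (insert a S) \<longleftrightarrow> cyclic_on v S"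
proof -
  have p: "swp a c \<circ> v permutes insert a S"
    by (rule transpose_comp_permutes[OF permutes_subset[OF S(3)]]) (use c in auto)
  have C: "orbit v c \<in> cycles_on S v" using c by (auto simp: cycles_on_def)
  have sub: "D \<subseteq> S" if "D \<in> cycles_on S v" for D
    using cycles_on_Union[OF S(1,3)] that by auto
  have "cyclic_on (swp a c \<circ> v) (insert a S) \<longleftrightarrow>
      insert (insert a (orbit v c)) (cycles_on S v - {orbit v c}) = {insert a S}"
    using cyclic_on_iff_cycles_on[OF _ _ p] S(1) cycles_on_insert[OF S(1,3) a c] by auto
  also have "\<dots> \<longleftrightarrow> cycles_on S v = {S}"
  proof
    assume eq: "insert (insert a (orbit v c)) (cycles_on S v - {orbit v c}) = {insert a S}"
    then have "insert a (orbit v c) = insert a S" by auto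
    then have "orbit v c = S" using sub[OF C] a by auto
    moreover have "cycles_on S v - {orbit v c} = {}"
    proof (rule ccontr)
      assume "cycles_on S v - {orbit v c} \<noteq> {}"
      then obtain D where "D \<in> cycles_on S v" "D = insert a S" using eq by blast
      then show False using sub a by auto
    qed
    ultimately show "cycles_on S v = {S}" using C by auto
  next
    assume "cycles_on S v = {S}"
    then show "insert (insert a (orbit v c)) (cycles_on S v - {orbit v c}) = {insert a S}"
      using C by auto
  qed
  also have "\<dots> \<longleftrightarrow> cyclic_on v S" by (simp add: cyclic_on_iff_cycles_on[OF S])
  finally show ?thesis .
qed

text \<open>A permutation of \<open>insert a S\<close> is \<open>swp a c \<circ> v\<close> for
  exactly one \<open>c\<close> and one \<open>v\<close> permuting \<open>S\<close>; the first sum is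
  the case \<open>c = a\<close>.\<close>

lemma sum_permutes_insert_if:
  fixes f :: "('a \<Rightarrow> 'a) \<Rightarrow> 'b::comm_monoid_add"
  assumes "finite S" "a \<notin> S"
  shows "(\<Sum>v | v permutes insert a S \<and> P v. f v) =
    (\<Sum>v | v permutes S \<and> P v. f v) +
    (\<Sum>c\<in>S. \<Sum>v | v permutes S \<and> P (swp a c \<circ> v). f (swp a c \<circ> v))"
proof -
  have fin: "finite {v. v permutes T}" if "finite T" for T :: "'a set"
    using finite_permutations[OF that] .
  \<comment> \<open>The condition is moved into the summand, so that the decomposition of
    unrestricted sums applies.\<close>
  have filt: "(\<Sum>v | v permutes T \<and> Q v. g v) = (\<Sum>v | v permutes T. if Q v then g v else 0)"
    if "finite T" for T Q and g :: "('a \<Rightarrow> 'a) \<Rightarrow> 'b"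
    using sum.inter_filter[OF fin[OF that], of g Q] by simp
  show ?thesis
    by (subst filt, use assms in simp, subst sum_over_permutations_insert[OF assms])
      (simp add: assms filt[OF assms(1)] cong: if_cong)
qed

text \<open>The case \<open>c = a\<close> drops out: it makes \<open>a\<close> a fixed point, while
  \<open>S\<close> is nonempty.\<close>

lemma sum_full_cycles_on_insert:
  fixes f :: "('a \<Rightarrow> 'a) \<Rightarrow> 'b::comm_monoid_add"
  assumes S: "finite S" "S \<noteq> {}" and a: "a \<notin> S"
  shows "(\<Sum>v\<in>full_cycles_on (insert a S). f v) =
    (\<Sum>c\<in>S. \<Sum>v\<in>full_cycles_on S. f (swp a c \<circ> v))"
proof -
  have "{v. v permutes S \<and> cyclic_on v (insert a S)} = {}"
  proof -
    have "\<not> cyclic_on v (insert a S)" if v: "v permutes S" for v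
    proof
      assume "cyclic_on v (insert a S)"
      then have "orbit v a = insert a S" using orbit_cyclic_eq3 by fastforce
      moreover have "orbit v a = {a}"
        using v a by (simp add: orbit_eq_singleton_iff permutes_not_in)
      ultimately show False using S(2) a by auto
    qed
    then show ?thesis by auto
  qed
  moreover have "{v. v permutes S \<and> cyclic_on (swp a c \<circ> v) (insert a S)} =
      full_cycles_on S" if "c \<in> S" for c
    using cyclic_on_insert_iff[OF S _ a that] unfolding full_cycles_on_def by auto
  ultimately show ?thesis
    unfolding full_cycles_on_def[of "insert a S"] sum_permutes_insert_if[OF S(1) a]
    by (simp only: sum.empty add_0 cong: sum.cong)
qed

lemma full_cycles_on_singleton: "full_cycles_on {a} = {id}"
proof -
  have "orbit id a = {a}" by (simp add: orbit_eq_singleton_iff)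
  then have "cyclic_on id {a}" by (simp only: cyclic_on_alldef) simp
  then show ?thesis by (auto simp: full_cycles_on_def)
qed

text \<open>The sum \<open>h w\<close> for a fixed real \<open>y\<close>. Reading it as a polynomial
  in \<open>y\<close> is postponed to the final comparison.\<close>

definition full_cycle_sum :: "real \<Rightarrow> 'a set \<Rightarrow> ('a \<Rightarrow> 'a) \<Rightarrow> real" where
  "full_cycle_sum y S w = (\<Sum>v\<in>full_cycles_on S. cycle_weight (\<lambda>_. y) S (w \<circ> v))"

lemma full_cycles_on_permutes: "v \<in> full_cycles_on S \<Longrightarrow> v permutes S"
  by (simp add: full_cycles_on_def)

text \<open>Conjugation by \<open>w\<close> maps \<open>swp a c\<close> to
  \<open>swp (w a) (w c)\<close>, and \<open>w a = a\<close>.\<close>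

lemma comp_transpose_permutes:
  assumes "w permutes S" "a \<notin> S"
  shows "w \<circ> swp a c = swp a (w c) \<circ> w"
proof
  fix x
  have "inj w" "w a = a" using assms by (auto simp: permutes_inj permutes_not_in)
  then have "w x = a \<longleftrightarrow> x = a" "w x = w c \<longleftrightarrow> x = c" by (metis inj_eq)+
  then show "(w \<circ> swp a c) x = (swp a (w c) \<circ> w) x"
    using \<open>w a = a\<close> by (auto simp: Transposition.transpose_def)
qed

text \<open>A full cycle on \<open>S\<close> extends in \<open>card S\<close> ways. The
  transposition can be moved to the left of \<open>w\<close>, where it only inserts \<open>a\<close>
  into a cycle of \<open>w \<circ> v\<close>.\<close>

lemma full_cycle_sum_insert_fixed:
  assumes S: "finite S" "S \<noteq> {}" "w permutes S" and a: "a \<notin> S"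
  shows "full_cycle_sum y (insert a S) w = real (card S) * full_cycle_sum y S w"
proof -
  have "cycle_weight (\<lambda>_. y) (insert a S) (w \<circ> (swp a c \<circ> v)) = cycle_weight (\<lambda>_. y) S (w \<circ> v)"
    if "c \<in> S" "v \<in> full_cycles_on S" for c v
  proof -
    have "w \<circ> (swp a c \<circ> v) = swp a (w c) \<circ> (w \<circ> v)"
      using comp_transpose_permutes[OF S(3) a, of c] by (metis comp_assoc)
    moreover have "w \<circ> v permutes S"
      using S(3) full_cycles_on_permutes[OF that(2)] by (rule permutes_compose[rotated])
    moreover have "w c \<in> S" using S(3) that(1) by (simp add: permutes_in_image)
    ultimately show ?thesis using cycle_weight_const_insert[OF S(1) _ a] by metis
  qed
  then show ?thesis
    unfolding full_cycle_sum_def sum_full_cycles_on_insert[OF S(1,2) a] by simp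
qed

text \<open>A full cycle on \<open>insert a S\<close> is \<open>(a c) v\<close> with \<open>v\<close> a full cycle on \<open>S\<close>.  Moving \<open>(a c)\<close> past
  \<open>w\<close> and using \<open>(a b)(a c) = (a c)(b c)\<close>, the element \<open>a\<close> can be deleted from its cycle.\<close>

lemma full_cycle_sum_insert:
  assumes S: "finite S" "w permutes S" and a: "a \<notin> S" and b: "b \<in> S"
  shows "full_cycle_sum y (insert a S) (swp a b \<circ> w) =
    y * full_cycle_sum y S w + (\<Sum>c\<in>S - {b}. full_cycle_sum y S (swp b c \<circ> w))"
proof -
  have ne: "S \<noteq> {}" using b by auto
  let ?W = "cycle_weight (\<lambda>_::nat. y)"
  have "(\<Sum>c\<in>S. ?W (insert a S) (swp a b \<circ> w \<circ> (swp a c \<circ> v))) =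
      y * ?W S (w \<circ> v) + (\<Sum>c\<in>S - {b}. ?W S (swp b c \<circ> w \<circ> v))"
    if v: "v \<in> full_cycles_on S" for v
  proof -
    have wv: "w \<circ> v permutes S"
      using S(2) full_cycles_on_permutes[OF v] by (rule permutes_compose[rotated])
    have "(\<Sum>c\<in>S. ?W (insert a S) (swp a b \<circ> w \<circ> (swp a c \<circ> v))) =
        (\<Sum>c\<in>S. ?W (insert a S) (swp a b \<circ> (swp a (w c) \<circ> (w \<circ> v))))"
    proof (rule sum.cong[OF refl])
      fix c
      have "swp a b \<circ> w \<circ> (swp a c \<circ> v) = swp a b \<circ> ((w \<circ> swp a c) \<circ> v)"
        by (simp only: comp_assoc)
      then show "?W (insert a S) (swp a b \<circ> w \<circ> (swp a c \<circ> v)) =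
          ?W (insert a S) (swp a b \<circ> (swp a (w c) \<circ> (w \<circ> v)))"
        unfolding comp_transpose_permutes[OF S(2) a] by (simp only: comp_assoc)
    qed
    \<comment> \<open>Since \<open>w\<close> permutes \<open>S\<close>, the sum over
      \<open>w c\<close> is a sum over \<open>c\<close>.\<close>
    also have "\<dots> = (\<Sum>c\<in>S. ?W (insert a S) (swp a b \<circ> (swp a c \<circ> (w \<circ> v))))"
      using sum.reindex_bij_betw[OF permutes_imp_bij[OF S(2)],
        of "\<lambda>c. ?W (insert a S) (swp a b \<circ> (swp a c \<circ> (w \<circ> v)))"] .
    \<comment> \<open>For \<open>c = b\<close> the two transpositions cancel, and the fixed point
      \<open>a\<close> contributes the factor \<open>y\<close>.\<close>
    also have "\<dots> = ?W (insert a S) (swp a b \<circ> (swp a b \<circ> (w \<circ> v))) +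
        (\<Sum>c\<in>S - {b}. ?W (insert a S) (swp a b \<circ> (swp a c \<circ> (w \<circ> v))))"
      using S(1) b by (rule sum.remove)
    also have "swp a b \<circ> (swp a b \<circ> (w \<circ> v)) = w \<circ> v"
      by (metis comp_assoc id_comp transpose_comp_involutory)
    also have "?W (insert a S) (w \<circ> v) = y * ?W S (w \<circ> v)"
      by (rule cycle_weight_insert_fixed[OF S(1) wv a])
    also have "(\<Sum>c\<in>S - {b}. ?W (insert a S) (swp a b \<circ> (swp a c \<circ> (w \<circ> v)))) =
        (\<Sum>c\<in>S - {b}. ?W S (swp b c \<circ> w \<circ> v))"
    proof (rule sum.cong[OF refl])
      fix c assume c: "c \<in> S - {b}"
      have "swp a b \<circ> swp a c = swp a c \<circ> swp b c"
        using a b c by (auto simp: fun_eq_iff Transposition.transpose_def)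
      then have "swp a b \<circ> (swp a c \<circ> (w \<circ> v)) = swp a c \<circ> (swp b c \<circ> (w \<circ> v))"
        by (metis comp_assoc)
      moreover have "swp b c \<circ> (w \<circ> v) permutes S"
        using c b wv by (intro transpose_comp_permutes) auto
      moreover have "c \<in> S" using c by simp
      ultimately show "?W (insert a S) (swp a b \<circ> (swp a c \<circ> (w \<circ> v))) = ?W S (swp b c \<circ> w \<circ> v)"
        using cycle_weight_const_insert[OF S(1) _ a] by (simp only: comp_assoc)
    qed
    finally show ?thesis .
  qed
  note pointwise = this
  let ?F = "full_cycles_on S"
  have "full_cycle_sum y (insert a S) (swp a b \<circ> w) =
      (\<Sum>c\<in>S. \<Sum>v\<in>?F. ?W (insert a S) (swp a b \<circ> w \<circ> (swp a c \<circ> v)))"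
    unfolding full_cycle_sum_def sum_full_cycles_on_insert[OF S(1) ne a] ..
  also have "\<dots> = (\<Sum>v\<in>?F. \<Sum>c\<in>S. ?W (insert a S) (swp a b \<circ> w \<circ> (swp a c \<circ> v)))"
    by (rule sum.swap)
  also have "\<dots> = (\<Sum>v\<in>?F. y * ?W S (w \<circ> v) + (\<Sum>c\<in>S - {b}. ?W S (swp b c \<circ> w \<circ> v)))"
    by (rule sum.cong[OF refl pointwise])
  also have "\<dots> = (\<Sum>v\<in>?F. y * ?W S (w \<circ> v)) + (\<Sum>v\<in>?F. \<Sum>c\<in>S - {b}. ?W S (swp b c \<circ> w \<circ> v))"
    by (rule sum.distrib)
  also have "(\<Sum>v\<in>?F. \<Sum>c\<in>S - {b}. ?W S (swp b c \<circ> w \<circ> v)) =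
      (\<Sum>c\<in>S - {b}. full_cycle_sum y S (swp b c \<circ> w))"
    unfolding full_cycle_sum_def by (rule sum.swap)
  also have "(\<Sum>v\<in>?F. y * ?W S (w \<circ> v)) = y * full_cycle_sum y S w"
    unfolding full_cycle_sum_def by (rule sum_distrib_left[symmetric])
  finally show ?thesis .
qed

section \<open>The generating function of products with full cycles\<close>

definition cycle_fps :: "nat \<Rightarrow> real fps" where
  "cycle_fps j = 1 - (1 - fps_X) ^ j"

text \<open>The power series \<open>(1 - X)\<close> to the power \<open>- y\<close>.\<close>

definition neg_binomial_fps :: "real \<Rightarrow> real fps" where
  "neg_binomial_fps y = Abs_fps (\<lambda>n. pochhammer y n / fact n)"

text \<open>The differential equation of \<open>(1 - X)\<close> to the power \<open>- y\<close>; in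
  this form the series enters \<open>coefficient_recurrence\<close>.\<close>

lemma neg_binomial_fps_deriv:
  "(1 - fps_X) * fps_deriv (neg_binomial_fps y) = fps_const y * neg_binomial_fps y"
proof (rule fps_ext)
  fix n
  show "((1 - fps_X) * fps_deriv (neg_binomial_fps y)) $ n = (fps_const y * neg_binomial_fps y) $ n"
    by (cases n) (simp_all add: neg_binomial_fps_def left_diff_distrib pochhammer_Suc
        divide_simps, simp add: algebra_simps)
qed

lemma cycle_fps_deriv:
  "(1 - fps_X) * fps_deriv (cycle_fps j) = of_nat j * (1 - fps_X) ^ j"
proof -
  have "(1 - fps_X :: real fps) * fps_deriv ((1 - fps_X) ^ j) = - (of_nat j * (1 - fps_X) ^ j)"
  proof (induction j)
    case (Suc j)
    have "(1 - fps_X :: real fps) * fps_deriv ((1 - fps_X) ^ Suc j) =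
        (1 - fps_X) * ((1 - fps_X) * fps_deriv ((1 - fps_X) ^ j)) - (1 - fps_X) ^ Suc j"
      by (simp add: algebra_simps)
    then show ?case unfolding Suc.IH by (simp add: algebra_simps)
  qed simp
  then show ?thesis by (simp add: cycle_fps_def)
qed

lemma cycle_fps_add:
  "cycle_fps (i + j) = cycle_fps j + (1 - fps_X) ^ j * cycle_fps i"
  by (simp add: cycle_fps_def power_add algebra_simps)

text \<open>The product rule. It expresses a sum over cycles, weighted by their lengths, by a
  derivative of the whole product.\<close>

lemma fps_deriv_prod_cycle:
  assumes "finite K"
  shows "(1 - fps_X) * fps_deriv (\<Prod>C\<in>K. cycle_fps (g C)) =
    (\<Sum>C\<in>K. of_nat (g C) * (1 - fps_X) ^ g C * (\<Prod>D\<in>K - {C}. cycle_fps (g D)))"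
  using assms
proof (induction K)
  case (insert A K)
  let ?P = "\<lambda>M. \<Prod>D\<in>M. cycle_fps (g D)"
  have "(\<Sum>C\<in>K. of_nat (g C) * (1 - fps_X) ^ g C * ?P (insert A K - {C})) =
      (\<Sum>C\<in>K. cycle_fps (g A) * (of_nat (g C) * (1 - fps_X) ^ g C * ?P (K - {C})))"
  proof (rule sum.cong[OF refl])
    fix C assume "C \<in> K"
    then have "insert A K - {C} = insert A (K - {C})" using insert.hyps by auto
    then show "of_nat (g C) * (1 - fps_X) ^ g C * ?P (insert A K - {C}) =
        cycle_fps (g A) * (of_nat (g C) * (1 - fps_X) ^ g C * ?P (K - {C}))"
      using insert.hyps by (simp add: algebra_simps)
  qed
  moreover have "(1 - fps_X) * fps_deriv (?P (insert A K)) =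
      ((1 - fps_X) * fps_deriv (cycle_fps (g A))) * ?P K +
      cycle_fps (g A) * ((1 - fps_X) * fps_deriv (?P K))"
    using insert.hyps by (simp add: algebra_simps)
  ultimately show ?case
    using insert by (simp add: cycle_fps_deriv sum_distrib_left)
qed simp

text \<open>In \<open>cycle_fps (s + j)\<close>, the summand \<open>cycle_fps j\<close> restores the
  full product, and the other summand gives its derivative. Later \<open>s\<close> is the length of
  a cycle to be joined with others, or \<open>s = 1\<close> when a point is inserted.\<close>

lemma sum_cycle_fps_shift:
  assumes "finite K"
  shows "(\<Sum>C\<in>K. of_nat (g C) * cycle_fps (s + g C) * (\<Prod>D\<in>K - {C}. cycle_fps (g D))) =
    of_nat (\<Sum>C\<in>K. g C) * (\<Prod>C\<in>K. cycle_fps (g C)) +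
    cycle_fps s * ((1 - fps_X) * fps_deriv (\<Prod>C\<in>K. cycle_fps (g C)))"
proof -
  have "of_nat (g C) * cycle_fps (s + g C) * (\<Prod>D\<in>K - {C}. cycle_fps (g D)) =
      of_nat (g C) * (\<Prod>D\<in>K. cycle_fps (g D)) +
      cycle_fps s * (of_nat (g C) * (1 - fps_X) ^ g C * (\<Prod>D\<in>K - {C}. cycle_fps (g D)))"
    if "C \<in> K" for C
    unfolding cycle_fps_add prod.remove[OF assms that] by (simp add: algebra_simps)
  then show ?thesis
    by (simp add: fps_deriv_prod_cycle[OF assms] sum.distrib sum_distrib_left sum_distrib_right)
qed

text \<open>With \<open>q = 1 - X\<close>, each product is \<open>1 + q^s - q^i - q^(s - i)\<close>,
  so only geometric sums occur; the factor \<open>X = 1 - q\<close> clears their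
  denominator.\<close>

lemma sum_cycle_fps_conv:
  assumes "0 < s"
  shows "fps_X * (\<Sum>i\<in>{1..<s}. cycle_fps i * cycle_fps (s - i)) =
    of_nat (s - 1) * (1 + (1 - fps_X) ^ s) * fps_X - 2 * ((1 - fps_X) - (1 - fps_X) ^ s)"
proof -
  let ?q = "1 - fps_X :: real fps"
  have geo: "fps_X * (\<Sum>i\<in>{1..<s}. ?q ^ i) = ?q - ?q ^ s"
    using assms
  proof (induction s rule: nat_induct_non_zero)
    case (Suc s)
    then show ?case by (simp add: algebra_simps)
  qed simp
  have rev: "(\<Sum>i\<in>{1..<s}. ?q ^ (s - i)) = (\<Sum>i\<in>{1..<s}. ?q ^ i)"
    by (rule sum.reindex_bij_witness[of _ "\<lambda>i. s - i" "\<lambda>i. s - i"]) auto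
  have "cycle_fps i * cycle_fps (s - i) = (1 + ?q ^ s) - (?q ^ i + ?q ^ (s - i))"
    if "i \<in> {1..<s}" for i
  proof -
    have "?q ^ i * ?q ^ (s - i) = ?q ^ s" using that by (simp add: power_add[symmetric])
    then show ?thesis by (simp add: cycle_fps_def algebra_simps)
  qed
  then have "(\<Sum>i\<in>{1..<s}. cycle_fps i * cycle_fps (s - i)) =
      (\<Sum>i\<in>{1..<s}. (1 + ?q ^ s) - (?q ^ i + ?q ^ (s - i)))"
    by (rule sum.cong[OF refl])
  also have "\<dots> = of_nat (s - 1) * (1 + ?q ^ s) - 2 * (\<Sum>i\<in>{1..<s}. ?q ^ i)"
    unfolding sum_subtractf sum.distrib[of "\<lambda>i. ?q ^ i"] rev by simp
  finally have eq: "(\<Sum>i\<in>{1..<s}. cycle_fps i * cycle_fps (s - i)) =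
      of_nat (s - 1) * (1 + ?q ^ s) - 2 * (\<Sum>i\<in>{1..<s}. ?q ^ i)" .
  have "fps_X * (\<Sum>i\<in>{1..<s}. cycle_fps i * cycle_fps (s - i)) =
      of_nat (s - 1) * (1 + ?q ^ s) * fps_X - 2 * (fps_X * (\<Sum>i\<in>{1..<s}. ?q ^ i))"
    unfolding eq by (simp add: algebra_simps)
  then show ?thesis unfolding geo .
qed

text \<open>The right-hand side is a coefficient of a power series \<open>G\<close> for which \<open>X G\<close> is
  \<open>n E cycle_fps (s + 1) Q\<close> plus \<open>X M' - (n + 2) M\<close> for some \<open>M\<close>; the latter has no term of
  degree \<open>n + 2\<close>.\<close>

lemma coefficient_recurrence:
  fixes Q :: "real fps" and y :: real and s t :: nat
  assumes s: "0 < s"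
  defines "E \<equiv> neg_binomial_fps y" and "n \<equiv> s + t"
  shows "real n * (E * (cycle_fps (s + 1) * Q)) $ (n + 2) =
    (E * (fps_const y * (cycle_fps s * Q) +
      ((\<Sum>i\<in>{1..<s}. cycle_fps i * cycle_fps (s - i)) * Q +
       (of_nat t * Q + cycle_fps s * ((1 - fps_X) * fps_deriv Q))))) $ (n + 1)"
    (is "_ = ?G $ (n + 1)")
proof -
  let ?q = "1 - fps_X :: real fps"
  define u where "u = cycle_fps s"
  \<comment> \<open>\<open>M\<close> is \<open>(1 - X) E\<close> times the weight \<open>u Q\<close>
    of a permutation before insertion. The factor \<open>1 - X\<close> allows its derivative to be
    computed from \<open>dE\<close>, \<open>du\<close> and \<open>(1 - X)\<close> times the
    derivative of \<open>Q\<close>.\<close>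
  define M where "M = u * ?q * (E * Q)"
  define Z where "Z = (\<Sum>i\<in>{1..<s}. cycle_fps i * cycle_fps (s - i))"
  have dE: "?q * fps_deriv E = fps_const y * E"
    unfolding E_def by (rule neg_binomial_fps_deriv)
  have du: "?q * fps_deriv u = of_nat s * (1 - u)"
    unfolding u_def cycle_fps_deriv by (simp add: cycle_fps_def)
  have us: "cycle_fps (s + 1) = 1 - ?q * (1 - u)"
    by (simp add: u_def cycle_fps_def)
  have "(of_nat (s - 1) :: real fps) = of_nat s - 1" using s by (simp add: of_nat_diff)
  then have Z: "fps_X * Z = (of_nat s - 1) * (2 - u) * fps_X - 2 * (?q - (1 - u))"
    using sum_cycle_fps_conv[OF s] by (simp add: Z_def u_def cycle_fps_def)
  have dM: "fps_deriv M = (?q * fps_deriv u) * E * Q - u * E * Q + u * (?q * fps_deriv E) * Q +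
      u * E * (?q * fps_deriv Q)"
    by (simp add: M_def algebra_simps)
  have "fps_X * ?G = fps_X * (fps_const y * E) * u * Q + (fps_X * Z) * E * Q +
      fps_X * of_nat t * E * Q + fps_X * u * E * (?q * fps_deriv Q)"
    by (simp add: Z_def u_def algebra_simps)
  \<comment> \<open>The rules above turn both sides into polynomials in \<open>X\<close>,
    \<open>u\<close>, \<open>E\<close>, \<open>Q\<close> and the derivative of \<open>Q\<close>,
    with \<open>1 - u\<close> in place of \<open>(1 - X)^s\<close>.\<close>
  also have "\<dots> = fps_X * fps_deriv M - of_nat (n + 2) * M +
      of_nat n * (E * (cycle_fps (s + 1) * Q))"
    unfolding dM du dE Z us by (simp add: M_def n_def algebra_simps)
  finally have XG: "fps_X * ?G = fps_X * fps_deriv M - of_nat (n + 2) * M +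
      of_nat n * (E * (cycle_fps (s + 1) * Q))" .
  have "?G $ (n + 1) = (fps_X * ?G) $ (n + 2)" by simp
  also have "\<dots> = (fps_X * fps_deriv M) $ (n + 2) - (of_nat (n + 2) * M) $ (n + 2) +
      (of_nat n * (E * (cycle_fps (s + 1) * Q))) $ (n + 2)"
    unfolding XG by simp
  also have "(fps_X * fps_deriv M) $ (n + 2) = real (n + 2) * M $ (n + 2)" by simp
  also have "(of_nat (n + 2) * M) $ (n + 2) = real (n + 2) * M $ (n + 2)"
    by (metis fps_mult_left_const_nth fps_of_nat)
  also have "(of_nat n * (E * (cycle_fps (s + 1) * Q))) $ (n + 2) =
      real n * (E * (cycle_fps (s + 1) * Q)) $ (n + 2)"
    by (metis fps_mult_left_const_nth fps_of_nat)
  finally show ?thesis by simp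
qed

lemma cycle_weight_singleton: "cycle_weight \<phi> {a} id = \<phi> 1"
proof -
  have "orbit id a = {a}" by (simp add: orbit_eq_singleton_iff)
  then have "cycles_on {a} id = {{a}}" by (simp only: cycles_on_def image_insert image_empty)
  then show ?thesis by (simp only: cycle_weight_def) simp
qed

text \<open>Induction on \<open>S\<close>. If \<open>w\<close> fixes the new element, the weight
  gains a factor \<open>X\<close>, which raises the degree by one. Otherwise the cut-and-join rule
  brings \<open>full_cycle_sum_insert\<close> into the form of the right-hand side of
  \<open>coefficient_recurrence\<close>.\<close>

lemma full_cycle_sum_eq:
  assumes "finite S" "S \<noteq> {}" "w permutes S"
  shows "full_cycle_sum y S w =
    fact (card S - 1) * (neg_binomial_fps y * cycle_weight cycle_fps S w) $ (card S + 1)"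
  using assms
proof (induction S arbitrary: w rule: finite_ne_induct)
  case (singleton a)
  have "w = id" using singleton by simp
  then have "full_cycle_sum y {a} w = cycle_weight (\<lambda>_. y) {a} id"
    by (simp only: full_cycle_sum_def full_cycles_on_singleton comp_id) simp
  \<comment> \<open>The identity is the only full cycle here, so the sum is \<open>y\<close>, which
    is the linear coefficient of \<open>neg_binomial_fps y\<close>.\<close>
  moreover have "(neg_binomial_fps y * fps_X) $ 2 = y"
    by (simp add: neg_binomial_fps_def numeral_2_eq_2)
  ultimately show ?case
    by (simp only: \<open>w = id\<close> cycle_weight_singleton) (simp add: cycle_fps_def numeral_2_eq_2)
next
  case (insert a S)
  define n where "n = card S"
  have n0: "0 < n" using insert.hyps by (simp add: n_def card_gt_0_iff)
  have cardS: "card (insert a S) = n + 1" using insert.hyps by (simp add: n_def)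
  have fact_n: "fact n = real n * fact (n - 1)" using n0 by (simp add: fact_reduce)
  let ?E = "neg_binomial_fps y" and ?W = "cycle_weight cycle_fps"
  have "w \<in> (\<lambda>(b, p). swp a b \<circ> p) ` {(b, p). b \<in> insert a S \<and> p \<in> {p. p permutes S}}"
    using insert.prems permutes_insert[of a S] by auto
  then obtain b v where v: "v permutes S" and b: "b \<in> insert a S" and w: "w = swp a b \<circ> v"
    by auto
  show ?case
  proof (cases "b = a")
    case True
    then have w: "w = v" using w by simp
    have "?W (insert a S) w = fps_X * ?W S w"
      using cycle_weight_insert_fixed[OF insert.hyps(1) v insert.hyps(3), of cycle_fps]
      by (simp add: w cycle_fps_def)
    then have "(?E * ?W (insert a S) w) $ (n + 2) = (?E * ?W S w) $ (n + 1)"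
      by (simp add: mult.left_commute[of _ fps_X])
    moreover have "full_cycle_sum y (insert a S) w = real n * full_cycle_sum y S w"
      using full_cycle_sum_insert_fixed[OF insert.hyps(1,2) v insert.hyps(3)] w n_def by simp
    ultimately show ?thesis
      using insert.IH[OF v] by (simp add: cardS w n_def[symmetric] fact_n)
  next
    case False
    then have b: "b \<in> S" using b by auto
    define B where "B = orbit v b"
    define K where "K = cycles_on S v"
    \<comment> \<open>\<open>s\<close> and \<open>t\<close> count the elements of \<open>S\<close>
      inside and outside the cycle of \<open>b\<close>; \<open>Q\<close> is the weight of the other
      cycles.\<close>
    define s where "s = card B"
    define t where "t = (\<Sum>C\<in>K - {B}. card C)"
    define Q where "Q = (\<Prod>C\<in>K - {B}. cycle_fps (card C))"
    have finK: "finite K" unfolding K_def by (rule finite_cycles_on[OF insert.hyps(1)])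
    have BK: "B \<in> K" using b by (auto simp: B_def K_def cycles_on_def)
    have s0: "0 < s"
      unfolding s_def B_def by (rule orbit_funpow_range(4)[OF permutes_permutation[OF insert.hyps(1) v]])
    have nst: "n = s + t"
    proof -
      have "n = (\<Sum>C\<in>K. card C)"
        using sum_over_cycles[OF insert.hyps(1) v order.refl, of "\<lambda>_. 1::nat"]
        unfolding cycles_on_Union[OF insert.hyps(1) v] by (simp add: K_def n_def)
      then show ?thesis unfolding s_def t_def using sum.remove[OF finK BK, of card] by simp
    qed
    let ?c = "\<lambda>f. fact (n - 1) * (?E * f) $ (n + 1) :: real"
    have "full_cycle_sum y (insert a S) w =
        y * full_cycle_sum y S v + (\<Sum>c\<in>S - {b}. full_cycle_sum y S (swp b c \<circ> v))"
      unfolding w by (rule full_cycle_sum_insert[OF insert.hyps(1) v insert.hyps(3) b])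
    also have "full_cycle_sum y S v = ?c (?W S v)"
      using insert.IH[OF v] by (simp add: n_def)
    also have "(\<Sum>c\<in>S - {b}. full_cycle_sum y S (swp b c \<circ> v)) =
        (\<Sum>c\<in>S - {b}. ?c (?W S (swp b c \<circ> v)))"
      unfolding n_def by (intro sum.cong refl insert.IH transpose_comp_permutes[OF v b]) simp
    also have "y * ?c (?W S v) + \<dots> =
        ?c (fps_const y * ?W S v + (\<Sum>c\<in>S - {b}. ?W S (swp b c \<circ> v)))"
      by (simp add: distrib_left sum_distrib_left fps_sum_nth mult.left_commute[of _ "fps_const y"])
    also have "(\<Sum>c\<in>S - {b}. ?W S (swp b c \<circ> v)) =
        (\<Sum>i\<in>{1..<s}. cycle_fps i * cycle_fps (s - i)) * Q +
        (of_nat t * Q + cycle_fps s * ((1 - fps_X) * fps_deriv Q))"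
      unfolding sum_cycle_weight_transpose[OF insert.hyps(1) v b] B_def[symmetric] K_def[symmetric]
        s_def[symmetric]
      using sum_cycle_fps_shift[of "K - {B}" card s] finK by (simp add: Q_def t_def)
    also have "?W S v = cycle_fps s * Q"
      using cycle_weight_remove[OF insert.hyps(1) b] by (simp add: s_def B_def Q_def K_def)
    also have "?c (fps_const y * (cycle_fps s * Q) +
        ((\<Sum>i\<in>{1..<s}. cycle_fps i * cycle_fps (s - i)) * Q +
        (of_nat t * Q + cycle_fps s * ((1 - fps_X) * fps_deriv Q)))) =
        fact (n - 1) * (real n * (?E * (cycle_fps (s + 1) * Q)) $ (n + 2))"
      unfolding nst by (subst coefficient_recurrence[OF s0]) simp
    also have "cycle_fps (s + 1) * Q = ?W (insert a S) w"
      unfolding w s_def B_def Q_def K_def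
      by (rule cycle_weight_insert[OF insert.hyps(1) v insert.hyps(3) b, symmetric])
    finally show ?thesis by (simp add: cardS fact_n)
  qed
qed

section \<open>The weight of separated permutations\<close>

text \<open>The predicate \<open>separated\<close> for an arbitrary ground set, which can then grow
  by one element at a time.\<close>

definition separated_on :: "'a set \<Rightarrow> 'a set list \<Rightarrow> ('a \<Rightarrow> 'a) \<Rightarrow> bool" where
  "separated_on S A w \<longleftrightarrow>
    (\<forall>C\<in>cycles_on S w. \<forall>i<length A. \<forall>j<length A.
      C \<inter> A ! i \<noteq> {} \<and> C \<inter> A ! j \<noteq> {} \<longrightarrow> i = j)"

definition separated_perms :: "'a set \<Rightarrow> 'a set list \<Rightarrow> ('a \<Rightarrow> 'a) set" where
  "separated_perms S A = {w. w permutes S \<and> separated_on S A w}"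

definition separated_weight :: "'a set \<Rightarrow> 'a set list \<Rightarrow> real fps" where
  "separated_weight S A = (\<Sum>w\<in>separated_perms S A. cycle_weight cycle_fps S w)"

lemma finite_separated_perms: "finite S \<Longrightarrow> finite (separated_perms S A)"
  unfolding separated_perms_def using finite_permutations[of S] by (auto elim: rev_finite_subset)

lemma separated_on_insert_fixed:
  assumes "finite S" "w permutes S" "a \<notin> S" "\<Union>(set A) \<subseteq> S"
  shows "separated_on (insert a S) A w \<longleftrightarrow> separated_on S A w"
proof -
  have "{a} \<inter> A ! i = {}" if "i < length A" for i
    using assms(3,4) nth_mem[OF that] by blast
  then show ?thesis
    unfolding separated_on_def cycles_on_insert_fixed[OF assms(1-3)] by auto
qed

text \<open>The element \<open>a\<close> lies in no block, so enlarging a cycle by \<open>a\<close>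
  changes none of its intersections with the blocks.\<close>

lemma separated_on_insert:
  assumes S: "finite S" "w permutes S" and a: "a \<notin> S" and b: "b \<in> S"
    and A: "\<Union>(set A) \<subseteq> S"
  shows "separated_on (insert a S) A (swp a b \<circ> w) \<longleftrightarrow> separated_on S A w"
proof -
  define P where "P C \<longleftrightarrow>
    (\<forall>i<length A. \<forall>j<length A. C \<inter> A ! i \<noteq> {} \<and> C \<inter> A ! j \<noteq> {} \<longrightarrow> i = j)" for C
  have sep: "separated_on T A v \<longleftrightarrow> (\<forall>C\<in>cycles_on T v. P C)" for T v
    by (simp add: separated_on_def P_def)
  have "insert a C \<inter> A ! i = C \<inter> A ! i" if "i < length A" for C i
    using a A nth_mem[OF that] by blast
  then have P: "P (insert a C) \<longleftrightarrow> P C" for C by (simp add: P_def)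
  have "orbit w b \<in> cycles_on S w" using b by (auto simp: cycles_on_def)
  then have K: "cycles_on S w = insert (orbit w b) (cycles_on S w - {orbit w b})" by auto
  have "(\<forall>C\<in>insert (insert a (orbit w b)) X. P C) \<longleftrightarrow> (\<forall>C\<in>insert (orbit w b) X. P C)" for X
    by (simp add: P)
  from this[of "cycles_on S w - {orbit w b}", folded K] show ?thesis
    unfolding sep cycles_on_insert[OF S a b] .
qed

text \<open>As a fixed point, \<open>a\<close> contributes the factor \<open>X\<close>. The
  insertions into cycles are summed by \<open>sum_cycle_fps_shift\<close> with \<open>s = 1\<close>;
  this gives the same linear differential operator for every \<open>w\<close>, so it can be applied
  to the whole sum.\<close>

lemma separated_weight_insert:
  assumes S: "finite S" and a: "a \<notin> S" and A: "\<Union>(set A) \<subseteq> S"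
  shows "separated_weight (insert a S) A =
    (fps_X + of_nat (card S)) * separated_weight S A +
    fps_X * ((1 - fps_X) * fps_deriv (separated_weight S A))"
proof -
  let ?W = "cycle_weight cycle_fps"
  let ?P = "separated_perms S A"
  have "separated_weight (insert a S) A =
      (\<Sum>w | w permutes S \<and> separated_on (insert a S) A w. ?W (insert a S) w) +
      (\<Sum>b\<in>S. \<Sum>w | w permutes S \<and> separated_on (insert a S) A (swp a b \<circ> w).
        ?W (insert a S) (swp a b \<circ> w))"
    unfolding separated_weight_def separated_perms_def by (rule sum_permutes_insert_if[OF S a])
  also have "{w. w permutes S \<and> separated_on (insert a S) A w} = ?P"
    unfolding separated_perms_def using separated_on_insert_fixed[OF S _ a A] by auto
  also have "(\<Sum>b\<in>S. \<Sum>w | w permutes S \<and> separated_on (insert a S) A (swp a b \<circ> w).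
        ?W (insert a S) (swp a b \<circ> w)) = (\<Sum>b\<in>S. \<Sum>w\<in>?P. ?W (insert a S) (swp a b \<circ> w))"
    by (intro sum.cong refl)
      (use separated_on_insert[OF S _ a _ A] in \<open>auto simp: separated_perms_def\<close>)
  also have "\<dots> = (\<Sum>w\<in>?P. \<Sum>b\<in>S. ?W (insert a S) (swp a b \<circ> w))"
    by (rule sum.swap)
  also have "\<dots> = (\<Sum>w\<in>?P. of_nat (card S) * ?W S w + fps_X * ((1 - fps_X) * fps_deriv (?W S w)))"
  proof (rule sum.cong[OF refl])
    fix w assume "w \<in> ?P"
    then have w: "w permutes S" by (simp add: separated_perms_def)
    have "card S = (\<Sum>C\<in>cycles_on S w. card C)"
      using sum_over_cycles[OF S w order.refl, of "\<lambda>_. 1::nat"]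
      unfolding cycles_on_Union[OF S w] by simp
    moreover have "cycle_fps 1 = fps_X" by (simp add: cycle_fps_def)
    ultimately show "(\<Sum>b\<in>S. ?W (insert a S) (swp a b \<circ> w)) =
        of_nat (card S) * ?W S w + fps_X * ((1 - fps_X) * fps_deriv (?W S w))"
      using sum_cycle_weight_insert[OF S w a, of cycle_fps]
        sum_cycle_fps_shift[OF finite_cycles_on[OF S, of w], of card 1]
      by (simp only: cycle_weight_def add.commute)
  qed
  also have "(\<Sum>w\<in>?P. ?W (insert a S) w) = (\<Sum>w\<in>?P. fps_X * ?W S w)"
    using cycle_weight_insert_fixed[OF S _ a, of _ cycle_fps]
    by (intro sum.cong) (auto simp: separated_perms_def cycle_fps_def)
  finally show ?thesis
    by (simp add: separated_weight_def sum.distrib sum_distrib_left fps_deriv_sum distrib_right)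
qed

section \<open>Sets that are exhausted by their blocks\<close>

lemma separated_weight_empty: "separated_weight {} [] = 1"
proof -
  have "separated_perms ({} :: 'a set) [] = {id}"
    by (auto simp: separated_perms_def separated_on_def)
  then show ?thesis
    by (simp add: separated_weight_def cycle_weight_def cycles_on_def)
qed

text \<open>Separation is vacuous without blocks, so this is the total weight of all permutations.
  The recurrence preserves multiples of \<open>X\<close>:
  \<open>(X + n) X + X (1 - X) = (n + 1) X\<close>.\<close>

lemma separated_weight_no_blocks:
  assumes "finite S" "S \<noteq> {}"
  shows "separated_weight S [] = fps_const (fact (card S)) * fps_X"
  using assms
proof (induction S rule: finite_ne_induct)
  case (singleton a)
  show ?case
    using separated_weight_insert[of "{}" a "[]"] by (simp add: separated_weight_empty)
next
  case (insert a S)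
  have "separated_weight (insert a S) [] =
      (of_nat (card S) + 1) * fps_const (fact (card S)) * fps_X"
    using separated_weight_insert[OF insert.hyps(1,3), of "[]"] insert.IH
    by (simp add: algebra_simps)
  also have "(of_nat (card S) + 1) * fps_const (fact (card S)) = fps_const (fact (card S + 1) :: real)"
    unfolding fps_of_nat[symmetric] fps_const_1_eq_1[symmetric] fps_const_add fps_const_mult by simp
  finally show ?case using insert.hyps by simp
qed

lemma cycles_on_comp_disjoint:
  assumes S: "finite S" "g permutes S" and T: "finite T" "h permutes T" and disj: "S \<inter> T = {}"
  shows "cycles_on (S \<union> T) (g \<circ> h) = cycles_on S g \<union> cycles_on T h"
proof -
  have "(g \<circ> h) x = g x" if "x \<in> S" for x
  proof -
    have "x \<notin> T" using that disj by auto
    then show ?thesis using T(2) by (simp add: permutes_not_in)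
  qed
  then have "orbit (g \<circ> h) x = orbit g x" if "x \<in> S" for x
    using that permutes_in_image[OF S(2)]
    by (intro orbit_cong0[of x S]) auto
  moreover have "(g \<circ> h) x = h x" if "x \<in> T" for x
  proof -
    have "h x \<notin> S" using that disj permutes_in_image[OF T(2), of x] by auto
    then show ?thesis using S(2) by (simp add: permutes_not_in)
  qed
  then have "orbit (g \<circ> h) x = orbit h x" if "x \<in> T" for x
    using that permutes_in_image[OF T(2)]
    by (intro orbit_cong0[of x T]) auto
  ultimately show ?thesis
    unfolding cycles_on_def image_Un by (metis image_cong)
qed

lemma perm_restrict_permutes:
  assumes "w permutes S" "finite T" "w ` T \<subseteq> T"
  shows "perm_restrict w T permutes T"
proof (rule bij_imp_permutes)
  have "inj_on w T" using assms(1) permutes_inj inj_on_subset by blast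
  then have "bij_betw w T T"
    using endo_inj_surj[OF assms(2,3)] by (simp add: bij_betw_def)
  then show "bij_betw (perm_restrict w T) T T"
    by (rule bij_betw_cong[THEN iffD1, rotated]) (simp add: perm_restrict_def)
qed (simp add: perm_restrict_def)

text \<open>No cycle joins \<open>B\<close> to another block, so a separated permutation preserves
  \<open>B\<close> and the union of the other blocks, and it is the product of its two restrictions.
  The restriction to \<open>B\<close> is arbitrary.\<close>

lemma separated_perms_Cons:
  assumes B: "finite B" and U: "finite (\<Union>(set A))" and disj: "B \<inter> \<Union>(set A) = {}"
  shows "bij_betw (\<lambda>(g, h). g \<circ> h) ({g. g permutes B} \<times> separated_perms (\<Union>(set A)) A)
    (separated_perms (B \<union> \<Union>(set A)) (B # A))"
proof -
  define U where "U = \<Union>(set A)"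
  have A: "A ! i \<subseteq> U" if "i < length A" for i
    unfolding U_def using nth_mem[OF that] by blast
  have finU: "finite U" and BU: "B \<inter> U = {}" using U disj by (auto simp: U_def)
  have gh: "(g \<circ> h) x = (if x \<in> B then g x else h x)" if "g permutes B" "h permutes U" for g h x
  proof (cases "x \<in> B")
    case True
    then have "x \<notin> U" using BU by auto
    then show ?thesis using True that(2) by (simp add: permutes_not_in)
  next
    case False
    show ?thesis
    proof (cases "x \<in> U")
      case True
      then have "h x \<notin> B" using permutes_in_image[OF that(2)] BU by auto
      then show ?thesis using \<open>x \<notin> B\<close> that(1) by (simp add: permutes_not_in)
    next
      case False
      then show ?thesis using \<open>x \<notin> B\<close> that by (simp add: permutes_not_in)
    qed
  qed
  have Cons_iff: "separated_on (B \<union> U) (B # A) (g \<circ> h) \<longleftrightarrow> separated_on U A h"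
    if g: "g permutes B" and h: "h permutes U" for g h
  proof -
    have cyc: "cycles_on (B \<union> U) (g \<circ> h) = cycles_on B g \<union> cycles_on U h"
      by (rule cycles_on_comp_disjoint[OF B g finU h BU])
    have CB: "C \<subseteq> B" if "C \<in> cycles_on B g" for C
      using cycles_on_Union[OF B g] that by auto
    have CU: "C \<subseteq> U" if "C \<in> cycles_on U h" for C
      using cycles_on_Union[OF finU h] that by auto
    show ?thesis
    proof
      assume L: "separated_on (B \<union> U) (B # A) (g \<circ> h)"
      show "separated_on U A h"
        unfolding separated_on_def
      proof (intro ballI allI impI)
        fix C i j
        assume "C \<in> cycles_on U h" "i < length A" "j < length A"
          "C \<inter> A ! i \<noteq> {} \<and> C \<inter> A ! j \<noteq> {}"
        then have "Suc i = Suc j"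
          using L[unfolded separated_on_def cyc, rule_format, of C "Suc i" "Suc j"] by simp
        then show "i = j" by simp
      qed
    next
      assume R: "separated_on U A h"
      show "separated_on (B \<union> U) (B # A) (g \<circ> h)"
        unfolding separated_on_def cyc
      proof (intro ballI allI impI)
        fix C i j
        assume C: "C \<in> cycles_on B g \<union> cycles_on U h"
          and i: "i < length (B # A)" and j: "j < length (B # A)"
          and ij: "C \<inter> (B # A) ! i \<noteq> {} \<and> C \<inter> (B # A) ! j \<noteq> {}"
        from C show "i = j"
        proof
          assume "C \<in> cycles_on B g"
          then have "C \<inter> A ! l = {}" if "l < length A" for l
            using CB A[OF that] BU by blast
          then show ?thesis using i j ij by (cases i; cases j) auto
        next
          assume C: "C \<in> cycles_on U h"
          then have "C \<inter> B = {}" using CU BU by blast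
          then obtain i' j' where "i = Suc i'" "j = Suc j'"
            using ij by (cases i; cases j) auto
          then show ?thesis
            using R[unfolded separated_on_def, rule_format, OF C, of i' j'] i j ij by simp
        qed
      qed
    qed
  qed
  show ?thesis
    unfolding U_def[symmetric]
  proof (rule bij_betw_imageI)
    show "inj_on (\<lambda>(g, h). g \<circ> h) ({g. g permutes B} \<times> separated_perms U A)"
    proof (rule inj_onI, clarsimp simp: separated_perms_def)
      fix g h g' h'
      assume p: "g permutes B" "h permutes U" "g' permutes B" "h' permutes U"
        and eq: "g \<circ> h = g' \<circ> h'"
      have "(if x \<in> B then g x else h x) = (if x \<in> B then g' x else h' x)" for x
        using gh[OF p(1,2), of x] gh[OF p(3,4), of x] eq by simp
      then have E: "x \<in> B \<Longrightarrow> g x = g' x" "x \<notin> B \<Longrightarrow> h x = h' x" for x by presburger+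
      have "g x = g' x" for x
        using E(1)[of x] p by (cases "x \<in> B") (auto simp: permutes_not_in)
      moreover have "h x = h' x" for x
        using E(2)[of x] p BU by (cases "x \<in> B") (auto simp: permutes_not_in disjoint_iff)
      ultimately show "g = g' \<and> h = h'" by auto
    qed
    show "(\<lambda>(g, h). g \<circ> h) ` ({g. g permutes B} \<times> separated_perms U A) =
        separated_perms (B \<union> U) (B # A)"
    proof (intro equalityI subsetI)
      fix w assume "w \<in> (\<lambda>(g, h). g \<circ> h) ` ({g. g permutes B} \<times> separated_perms U A)"
      then obtain g h where gh': "g permutes B" "h permutes U" "separated_on U A h" "w = g \<circ> h"
        by (auto simp: separated_perms_def)
      have "g permutes B \<union> U" "h permutes B \<union> U"
        using gh'(1,2) by (auto intro: permutes_subset)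
      then have "w permutes B \<union> U" unfolding gh'(4) by (intro permutes_compose)
      then show "w \<in> separated_perms (B \<union> U) (B # A)"
        using Cons_iff[OF gh'(1,2)] gh' by (simp add: separated_perms_def)
    next
      fix w assume "w \<in> separated_perms (B \<union> U) (B # A)"
      then have w: "w permutes B \<union> U" and sep: "separated_on (B \<union> U) (B # A) w"
        by (auto simp: separated_perms_def)
      have wp: "permutation w" using w B finU permutes_permutation by blast
      \<comment> \<open>In the list \<open>B # A\<close>, the block \<open>B\<close> has index
        \<open>0\<close> and the block of \<open>y\<close> has index \<open>Suc i\<close>, so a
        common cycle contradicts separation.\<close>
      have False if y: "y \<in> orbit w x" and xB: "x \<in> B" and yU: "y \<in> U" for x y
      proof -
        have "orbit w x \<in> cycles_on (B \<union> U) w" using xB by (auto simp: cycles_on_def)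
        moreover obtain i where i: "i < length A" "y \<in> A ! i"
          using yU unfolding U_def by (auto simp: in_set_conv_nth)
        moreover have "x \<in> orbit w x" by (rule permutation_self_in_orbit[OF wp])
        ultimately show False
          using sep[unfolded separated_on_def, rule_format, of "orbit w x" 0 "Suc i"] xB y by auto
      qed
      note mix = this
      have wB: "w ` B \<subseteq> B"
      proof
        fix y assume "y \<in> w ` B"
        then obtain x where x: "x \<in> B" "y = w x" by auto
        have "y \<in> B \<union> U" using x permutes_in_image[OF w, of x] by auto
        then show "y \<in> B" using mix[of y x] x by (auto intro: orbit.base)
      qed
      have wU: "w ` U \<subseteq> U"
      proof
        fix y assume "y \<in> w ` U"
        then obtain x where x: "x \<in> U" "y = w x" by auto
        have yBU: "y \<in> B \<union> U" using x permutes_in_image[OF w, of x] by auto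
        \<comment> \<open>\<open>mix\<close> speaks of orbits that start in \<open>B\<close>; hence
          the cycle is followed from \<open>w x\<close> back to \<open>x\<close>.\<close>
        have "x \<in> orbit w y"
          using orbit_swap[OF permutation_self_in_orbit[OF wp] orbit.base] x(2) by simp
        then show "y \<in> U" using mix[of x y] x yBU by auto
      qed
      let ?g = "perm_restrict w B" and ?h = "perm_restrict w U"
      have g: "?g permutes B" by (rule perm_restrict_permutes[OF w B wB])
      have h: "?h permutes U" by (rule perm_restrict_permutes[OF w finU wU])
      have eq: "w = ?g \<circ> ?h"
      proof
        fix x show "w x = (?g \<circ> ?h) x"
          unfolding gh[OF g h] using w by (auto simp: perm_restrict_def permutes_not_in)
      qed
      have "separated_on U A ?h" using Cons_iff[OF g h] sep eq by simp
      then show "w \<in> (\<lambda>(g, h). g \<circ> h) ` ({g. g permutes B} \<times> separated_perms U A)"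
        using eq g h by (intro image_eqI[of _ _ "(?g, ?h)"]) (auto simp: separated_perms_def)
    qed
  qed
qed

lemma cycle_weight_comp_disjoint:
  assumes S: "finite S" "g permutes S" and T: "finite T" "h permutes T" and disj: "S \<inter> T = {}"
  shows "cycle_weight \<phi> (S \<union> T) (g \<circ> h) = cycle_weight \<phi> S g * cycle_weight \<phi> T h"
proof -
  have "C \<noteq> {}" if "C \<in> cycles_on S g" for C
    using that orbit_nonempty[of g] by (auto simp: cycles_on_def)
  moreover have "\<Union>(cycles_on S g) \<inter> \<Union>(cycles_on T h) = {}"
    using disj by (simp only: cycles_on_Union S T)
  ultimately have "cycles_on S g \<inter> cycles_on T h = {}" by blast
  then show ?thesis
    unfolding cycle_weight_def cycles_on_comp_disjoint[OF assms]
    by (intro prod.union_disjoint finite_cycles_on S T)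
qed

lemma separated_weight_blocks:
  assumes "\<And>i. i < length A \<Longrightarrow> finite (A ! i) \<and> A ! i \<noteq> {}"
    and "\<And>i j. i < length A \<Longrightarrow> j < length A \<Longrightarrow> i \<noteq> j \<Longrightarrow> A ! i \<inter> A ! j = {}"
  shows "separated_weight (\<Union>(set A)) A =
    fps_const (\<Prod>i<length A. fact (card (A ! i))) * fps_X ^ length A"
  using assms
proof (induction A)
  case Nil
  show ?case by (simp add: separated_weight_empty)
next
  case (Cons B A)
  let ?U = "\<Union>(set A)" and ?W = "cycle_weight cycle_fps"
  have B: "finite B" "B \<noteq> {}" using Cons.prems(1)[of 0] by auto
  have A: "finite (A ! i) \<and> A ! i \<noteq> {}" if "i < length A" for i
    using Cons.prems(1)[of "Suc i"] that by auto
  have AA: "A ! i \<inter> A ! j = {}" if "i < length A" "j < length A" "i \<noteq> j" for i j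
    using Cons.prems(2)[of "Suc i" "Suc j"] that by auto
  have "finite C" if "C \<in> set A" for C using that A by (metis in_set_conv_nth)
  then have finU: "finite ?U" by (intro finite_Union) auto
  have "B \<inter> A ! i = {}" if "i < length A" for i
    using Cons.prems(2)[of 0 "Suc i"] that by auto
  then have BU: "B \<inter> ?U = {}" by (force simp: in_set_conv_nth)
  have "separated_weight (B \<union> ?U) (B # A) =
      (\<Sum>(g, h)\<in>{g. g permutes B} \<times> separated_perms ?U A. ?W (B \<union> ?U) (g \<circ> h))"
    unfolding separated_weight_def
    using sum.reindex_bij_betw[OF separated_perms_Cons[OF B(1) finU BU], of "?W (B \<union> ?U)"]
    by (simp add: case_prod_unfold)
  also have "\<dots> = (\<Sum>(g, h)\<in>{g. g permutes B} \<times> separated_perms ?U A. ?W B g * ?W ?U h)"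
    using cycle_weight_comp_disjoint[OF B(1) _ finU _ BU]
    by (intro sum.cong) (auto simp: separated_perms_def)
  also have "\<dots> = (\<Sum>g | g permutes B. ?W B g) * separated_weight ?U A"
    unfolding separated_weight_def sum_product sum.cartesian_product ..
  \<comment> \<open>For an empty list of blocks every permutation of \<open>B\<close> is
    separated.\<close>
  also have "(\<Sum>g | g permutes B. ?W B g) = separated_weight B []"
    by (simp add: separated_weight_def separated_perms_def separated_on_def)
  also have "separated_weight B [] = fps_const (fact (card B)) * fps_X"
    by (rule separated_weight_no_blocks[OF B])
  also have "separated_weight ?U A =
      fps_const (\<Prod>i<length A. fact (card (A ! i))) * fps_X ^ length A"
    by (rule Cons.IH[OF A AA])
  also have "fps_const (fact (card B)) * fps_X *
      (fps_const (\<Prod>i<length A. fact (card (A ! i))) * fps_X ^ length A) =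
      fps_const (fact (card B) * (\<Prod>i<length A. fact (card (A ! i)) :: real)) * fps_X ^ Suc (length A)"
    unfolding fps_const_mult[symmetric] by (simp only: power_Suc ac_simps)
  also have "fact (card B) * (\<Prod>i<length A. fact (card (A ! i)) :: real) =
      (\<Prod>i<length (B # A). fact (card ((B # A) ! i)))"
    unfolding length_Cons prod.lessThan_Suc_shift by simp
  finally show ?case by simp
qed

text \<open>The solution of the recurrence of \<open>separated_weight_insert\<close>, after removal of a constant and of
  the factor \<open>X\<close> to the number of blocks; \<open>k\<close>, \<open>m\<close>, \<open>d\<close> are the numbers of blocks, of elements in
  the blocks and of remaining elements.\<close>

definition separation_fps :: "real \<Rightarrow> real \<Rightarrow> nat \<Rightarrow> real fps" where
  "separation_fps k m d = Abs_fps (\<lambda>r. if r \<le> d then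
    fact d * ((1 - k) gchoose r) * ((m + real d + k - 1) gchoose (d - r)) else 0)"

text \<open>On coefficients this is a three-term relation, which follows from Pascal's rule and
  absorption. The term with \<open>fps_const k\<close> stems from the power of \<open>X\<close> that
  was split off.\<close>

lemma separation_fps_Suc:
  "separation_fps k m (Suc d) =
    (fps_X + fps_const (m + real d) + fps_const k * (1 - fps_X)) * separation_fps k m d +
    fps_X * ((1 - fps_X) * fps_deriv (separation_fps k m d))"
proof (rule fps_ext)
  fix r
  let ?R = "separation_fps k m"
  define M where "M = m + real d + k - 1"
  \<comment> \<open>The absorption identity, used for both binomial coefficients of
    \<open>separation_fps\<close>.\<close>
  have step: "(real e + 1) * (x gchoose Suc e) = (x - real e) * (x gchoose e)" for x :: real and e
    using gbinomial_mult_1[of x e] by (simp add: algebra_simps)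
  have "((fps_X + fps_const (m + real d) + fps_const k * (1 - fps_X)) * ?R d +
      fps_X * ((1 - fps_X) * fps_deriv (?R d))) $ r =
      (m + real d + k + real r) * ?R d $ r +
      (if r = 0 then 0 else (2 - k - real r) * ?R d $ (r - 1))"
  proof (cases r)
    case (Suc r')
    then show ?thesis
      by (cases r') (simp_all add: distrib_right left_diff_distrib mult.assoc algebra_simps)
  qed (simp add: distrib_right left_diff_distrib mult.assoc)
  \<comment> \<open>For \<open>r = d + 1\<close> only the coefficient of degree \<open>d\<close>
    contributes, and for larger \<open>r\<close> both sides vanish.\<close>
  also have "\<dots> = ?R (Suc d) $ r"
  proof (cases "r \<le> d")
    case True
    define e where "e = d - r"
    have d: "real d = real e + real r" "Suc d - r = Suc e" using True by (auto simp: e_def)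
    have pascal: "((M + 1) gchoose Suc e) = (M gchoose Suc e) + (M gchoose e)"
      by (simp add: gbinomial_Suc_Suc)
    have e1: "(if r = 0 then 0 else (2 - k - real r) * ?R d $ (r - 1)) =
        fact d * (real r * ((1 - k) gchoose r)) * (M gchoose Suc e)"
    proof (cases r)
      case (Suc r')
      have "d - r' = Suc e" using True Suc by (simp add: e_def)
      moreover have "(2 - k - real r) * ((1 - k) gchoose r') = real r * ((1 - k) gchoose r)"
        using step[of r' "1 - k"] Suc by (simp add: algebra_simps)
      moreover have "?R d $ r' = fact d * ((1 - k) gchoose r') * (M gchoose (d - r'))"
        using True Suc by (simp add: separation_fps_def M_def)
      ultimately have "(2 - k - real r) * ?R d $ r' =
          fact d * ((2 - k - real r) * ((1 - k) gchoose r')) * (M gchoose Suc e)"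
        by (simp only: ac_simps)
      then show ?thesis
        unfolding \<open>(2 - k - real r) * ((1 - k) gchoose r') = real r * ((1 - k) gchoose r)\<close>
        using Suc by simp
    qed simp
    have e2: "?R d $ r = fact d * ((1 - k) gchoose r) * (M gchoose e)"
      using True by (simp add: separation_fps_def M_def e_def)
    have e3: "?R (Suc d) $ r =
        fact d * ((1 - k) gchoose r) * ((real d + 1) * ((M + 1) gchoose Suc e))"
    proof -
      have "m + real (Suc d) + k - 1 = M + 1" by (simp add: M_def)
      moreover have "fact (Suc d) = (real d + 1) * fact d" by simp
      ultimately show ?thesis using True d(2) by (simp add: separation_fps_def del: fact_Suc)
    qed
    \<comment> \<open>Pascal's rule, followed by absorption for the part \<open>e + 1\<close> of
      \<open>d + 1 = (e + 1) + r\<close>.\<close>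
    have e4: "(real d + 1) * ((M + 1) gchoose Suc e) =
        (M + 1 + real r) * (M gchoose e) + real r * (M gchoose Suc e)"
      unfolding pascal d using step[of e M] by (simp add: algebra_simps)
    have e5: "m + real d + k + real r = M + 1 + real r" by (simp add: M_def)
    show ?thesis unfolding e1 e2 e3 e4 e5 by (simp only: algebra_simps)
  next
    case False
    show ?thesis
    proof (cases "r = Suc d")
      case True
      have "(2 - k - real r) * ((1 - k) gchoose d) = real r * ((1 - k) gchoose r)"
        using step[of d "1 - k"] True by (simp add: algebra_simps)
      then have "(2 - k - real r) * (fact d * ((1 - k) gchoose d)) =
          fact d * (real r * ((1 - k) gchoose r))"
        by (metis mult.left_commute)
      then show ?thesis using True by (simp add: separation_fps_def)
    next
      case False
      then have "\<not> r - 1 \<le> d" using \<open>\<not> r \<le> d\<close> by linarith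
      then show ?thesis using False \<open>\<not> r \<le> d\<close> by (simp add: separation_fps_def)
    qed
  qed
  finally show "?R (Suc d) $ r = ((fps_X + fps_const (m + real d) + fps_const k * (1 - fps_X)) * ?R d +
      fps_X * ((1 - fps_X) * fps_deriv (?R d))) $ r" by simp
qed

text \<open>Induction on the set of elements outside the blocks, starting from
  \<open>separated_weight_blocks\<close>. Once the constant and the power of \<open>X\<close> are
  factored out, \<open>separated_weight_insert\<close> becomes
  \<open>separation_fps_Suc\<close>.\<close>

lemma separated_weight_eq:
  assumes "\<And>i. i < length A \<Longrightarrow> finite (A ! i) \<and> A ! i \<noteq> {}"
    and "\<And>i j. i < length A \<Longrightarrow> j < length A \<Longrightarrow> i \<noteq> j \<Longrightarrow> A ! i \<inter> A ! j = {}"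
    and "finite D" "D \<inter> \<Union>(set A) = {}"
  shows "separated_weight (\<Union>(set A) \<union> D) A =
    fps_const (\<Prod>i<length A. fact (card (A ! i))) * fps_X ^ length A *
      separation_fps (real (length A)) (real (card (\<Union>(set A)))) (card D)"
  using assms(3,4)
proof (induction D)
  case empty
  have "separation_fps k m 0 = 1" for k m
    by (rule fps_ext) (simp add: separation_fps_def)
  then show ?case using separated_weight_blocks[OF assms(1,2)] by simp
next
  case (insert a D)
  let ?U = "\<Union>(set A)"
  define k where "k = length A"
  define c where "c = fps_const (\<Prod>i<length A. fact (card (A ! i)) :: real)"
  define R where "R = separation_fps (real k) (real (card ?U)) (card D)"
  have "finite B" if "B \<in> set A" for B using that assms(1) by (metis in_set_conv_nth)
  then have finU: "finite ?U" by (intro finite_Union) auto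
  have card: "card (?U \<union> D) = card ?U + card D"
    using finU insert by (intro card_Un_disjoint) auto
  have IH: "separated_weight (?U \<union> D) A = c * fps_X ^ k * R"
    using insert by (simp add: c_def k_def R_def)
  \<comment> \<open>The Euler operator multiplies \<open>X^k\<close> by \<open>k\<close>; this is
    the source of the term \<open>k (1 - X)\<close> in the recurrence for \<open>R\<close>.\<close>
  have dX: "fps_X * fps_deriv (fps_X ^ k :: real fps) = fps_const (real k) * fps_X ^ k" for k
  proof (induction k)
    case (Suc k)
    have "fps_X * fps_deriv (fps_X ^ Suc k :: real fps) =
        fps_X ^ Suc k + fps_X * (fps_X * fps_deriv (fps_X ^ k))"
      by (simp add: algebra_simps)
    also have "\<dots> = (1 + fps_const (real k)) * fps_X ^ Suc k"
      unfolding Suc.IH by (simp add: algebra_simps)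
    also have "1 + fps_const (real k) = fps_const (real (Suc k))"
      by (simp add: fps_const_1_eq_1[symmetric] del: fps_const_1_eq_1)
    finally show ?case .
  qed simp
  have "separated_weight (?U \<union> insert a D) A = separated_weight (insert a (?U \<union> D)) A" by simp
  also have "\<dots> = (fps_X + of_nat (card (?U \<union> D))) * (c * fps_X ^ k * R) +
      fps_X * ((1 - fps_X) * fps_deriv (c * fps_X ^ k * R))"
    unfolding IH[symmetric] by (rule separated_weight_insert) (use finU insert in auto)
  also have "fps_deriv (c * fps_X ^ k * R) = c * (fps_deriv (fps_X ^ k) * R + fps_X ^ k * fps_deriv R)"
    by (simp add: c_def algebra_simps)
  also have "(fps_X + of_nat (card (?U \<union> D))) * (c * fps_X ^ k * R) +
      fps_X * ((1 - fps_X) * (c * (fps_deriv (fps_X ^ k) * R + fps_X ^ k * fps_deriv R))) =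
      c * ((fps_X + of_nat (card (?U \<union> D))) * fps_X ^ k * R +
      (1 - fps_X) * ((fps_X * fps_deriv (fps_X ^ k)) * R + fps_X ^ k * (fps_X * fps_deriv R)))"
    by (simp only: algebra_simps)
  also have "\<dots> = c * fps_X ^ k * ((fps_X + of_nat (card (?U \<union> D)) +
      fps_const (real k) * (1 - fps_X)) * R + fps_X * ((1 - fps_X) * fps_deriv R))"
    unfolding dX by (simp only: algebra_simps)
  also have "of_nat (card (?U \<union> D)) = fps_const (real (card ?U) + real (card D))"
    by (simp add: card fps_of_nat[symmetric])
  also have "(fps_X + fps_const (real (card ?U) + real (card D)) +
      fps_const (real k) * (1 - fps_X)) * R + fps_X * ((1 - fps_X) * fps_deriv R) =
      separation_fps (real k) (real (card ?U)) (Suc (card D))"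
    unfolding R_def by (rule separation_fps_Suc[symmetric])
  finally show ?case using insert.hyps by (simp add: c_def k_def)
qed

section \<open>Counting\<close>

text \<open>With constant weight \<open>2\<close>, \<open>cycle_weight\<close> is a power of
  \<open>2\<close>, and its exponent, the number of cycles, can be recovered.\<close>

lemma card_cycles_on_insert:
  assumes "finite S" "w permutes S" "a \<notin> S" "b \<in> S"
  shows "card (cycles_on (insert a S) (swp a b \<circ> w)) = card (cycles_on S w)"
  using cycle_weight_const_insert[OF assms, of "2::nat"] by (simp add: cycle_weight_def)

text \<open>A new element is either a fixed point, with factor \<open>y\<close>, or is inserted next
  to one of the \<open>card S\<close> others without a change of the weight; together this is the
  factor \<open>y + card S\<close>.\<close>

lemma sum_cycle_weight_const:
  fixes y :: "'b::comm_ring_1"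
  assumes "finite S"
  shows "(\<Sum>w | w permutes S. cycle_weight (\<lambda>_. y) S w) = pochhammer y (card S)"
  using assms
proof (induction S)
  case empty
  then show ?case by (simp add: cycle_weight_def cycles_on_def)
next
  case (insert a S)
  let ?W = "cycle_weight (\<lambda>_::nat. y)"
  have "(\<Sum>w | w permutes insert a S. ?W (insert a S) w) =
      (\<Sum>w | w permutes S. ?W (insert a S) w) +
      (\<Sum>b\<in>S. \<Sum>w | w permutes S. ?W (insert a S) (swp a b \<circ> w))"
    using sum_permutes_insert_if[OF insert.hyps(1,2), of "?W (insert a S)" "\<lambda>_. True"]
    by (simp only: simp_thms)
  also have "(\<Sum>w | w permutes S. ?W (insert a S) w) = (\<Sum>w | w permutes S. y * ?W S w)"
    using cycle_weight_insert_fixed[OF insert.hyps(1) _ insert.hyps(2)] by (intro sum.cong) auto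
  also have "(\<Sum>b\<in>S. \<Sum>w | w permutes S. ?W (insert a S) (swp a b \<circ> w)) =
      (\<Sum>b\<in>S. \<Sum>w | w permutes S. ?W S w)"
    by (intro sum.cong refl cycle_weight_const_insert[OF insert.hyps(1) _ insert.hyps(2)]) auto
  finally show ?case
    using insert by (simp add: sum_distrib_left[symmetric] pochhammer_Suc algebra_simps)
qed

lemma card_cycles_on_le: "finite S \<Longrightarrow> card (cycles_on S w) \<le> card S"
  by (simp add: cycles_on_def card_image_le)

lemma sum_power_by_value:
  fixes y :: "'b::comm_semiring_1"
  assumes "finite P" "\<And>x. x \<in> P \<Longrightarrow> f x \<le> N"
  shows "(\<Sum>x\<in>P. y ^ f x) = (\<Sum>p\<le>N. of_nat (card {x \<in> P. f x = p}) * y ^ p)"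
proof -
  have "(\<Sum>x\<in>P. y ^ f x) = (\<Sum>p\<le>N. \<Sum>x\<in>{x \<in> P. f x = p}. y ^ f x)"
    using assms by (intro sum.group[symmetric]) auto
  also have "\<dots> = (\<Sum>p\<le>N. of_nat (card {x \<in> P. f x = p}) * y ^ p)"
    by (intro sum.cong) auto
  finally show ?thesis .
qed

text \<open>The bound \<open>N\<close> may exceed \<open>j\<close>, so that polynomials of different
  degrees can be added over one range of exponents.\<close>

lemma pochhammer_stirling_c:
  assumes "j \<le> N"
  shows "pochhammer (y :: real) j = (\<Sum>p\<le>N. real (stirling_c j p) * y ^ p)"
proof -
  have "card (cycles_on {1..j} w) \<le> N" for w
    using card_cycles_on_le[of "{1..j}" w] assms by simp
  then show ?thesis
    using sum_cycle_weight_const[of "{1..j}" y] finite_permutations[of "{1..j}"]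
      sum_power_by_value[of "{w. w permutes {1..j}}" "\<lambda>w. card (cycles_on {1..j} w)" N y]
    by (simp add: cycle_weight_def stirling_c_def perms_with_cycles_def)
qed

text \<open>Ensures that the uniform distribution is taken over a nonempty set. New elements are
  inserted into existing cycles, unless as many cycles as elements are wanted; then the identity
  serves.\<close>

lemma exists_perm_with_cycles:
  assumes "finite S" "0 < p" "p \<le> card S"
  shows "\<exists>w. w permutes S \<and> card (cycles_on S w) = p"
  using assms
proof (induction S)
  case (insert a S)
  show ?case
  proof (cases "p \<le> card S")
    case True
    then obtain w where w: "w permutes S" "card (cycles_on S w) = p" using insert by auto
    obtain b where b: "b \<in> S" using True insert.prems(1) by fastforce
    have "swp a b \<circ> w permutes insert a S"
      using b by (intro transpose_comp_permutes permutes_subset[OF w(1)]) auto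
    then show ?thesis
      using card_cycles_on_insert[OF insert.hyps(1) w(1) insert.hyps(2) b] w(2) by auto
  next
    case False
    have "orbit id x = {x}" for x :: 'a by (simp add: orbit_eq_singleton_iff)
    then have "cycles_on (insert a S) id = (\<lambda>x. {x}) ` insert a S"
      unfolding cycles_on_def by (intro image_cong) auto
    then have "card (cycles_on (insert a S) id) = card (insert a S)"
      by (simp only:) (rule card_image, simp)
    moreover have "p = card (insert a S)" using False insert.prems(2) insert.hyps by simp
    ultimately show ?thesis using permutes_id by blast
  qed
qed simp

lemma card_full_cycles_on:
  assumes "finite S" "S \<noteq> {}"
  shows "card (full_cycles_on S) = fact (card S - 1)"
  using assms
proof (induction S rule: finite_ne_induct)
  case (singleton a)
  show ?case by (simp add: full_cycles_on_singleton)
next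
  case (insert a S)
  have "card (full_cycles_on (insert a S)) = card S * card (full_cycles_on S)"
    using sum_full_cycles_on_insert[OF insert.hyps(1-3), of "\<lambda>_. 1::nat"] by simp
  also have "\<dots> = fact (card S)"
    using insert.IH insert.hyps by (simp add: fact_reduce[of "card S"] card_gt_0_iff)
  finally show ?case using insert.hyps by simp
qed

section \<open>The probability as a count of factorizations\<close>

lemma inv_full_cycles_on:
  assumes "finite S" "v \<in> full_cycles_on S"
  shows "inv v \<in> full_cycles_on S"
proof -
  have v: "v permutes S" "cyclic_on v S" using assms(2) by (auto simp: full_cycles_on_def)
  have "cyclic_on (inv v) S"
    using v(2) unfolding cyclic_on_def
    by (simp add: orbit_inv_eq permutes_permutation[OF assms(1) v(1)])
  then show ?thesis using permutes_inv[OF v(1)] by (simp add: full_cycles_on_def)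
qed

text \<open>A pair \<open>(u, v)\<close> of the random experiment is encoded as
  \<open>(u \<circ> v, inv v)\<close>: the product becomes the first component, and the factor with
  \<open>p\<close> cycles is recovered as \<open>w \<circ> v\<close>, as in
  \<open>full_cycle_sum\<close>.\<close>

definition separated_factorizations :: "nat \<Rightarrow> nat \<Rightarrow> nat set list \<Rightarrow> ((nat \<Rightarrow> nat) \<times> (nat \<Rightarrow> nat)) set" where
  "separated_factorizations n p A = {(w, v). w \<in> separated_perms {1..n} A \<and>
    v \<in> full_cycles_on {1..n} \<and> card (cycles_on {1..n} (w \<circ> v)) = p}"

lemma pair_pmf_of_set:
  assumes "finite P" "P \<noteq> {}" "finite Q" "Q \<noteq> {}"
  shows "pair_pmf (pmf_of_set P) (pmf_of_set Q) = pmf_of_set (P \<times> Q)"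
proof (rule pmf_eqI)
  fix x
  have "pmf (pmf_of_set (P \<times> Q)) x = indicator (P \<times> Q) x / real (card (P \<times> Q))"
    using assms by (intro pmf_of_set) auto
  then show "pmf (pair_pmf (pmf_of_set P) (pmf_of_set Q)) x = pmf (pmf_of_set (P \<times> Q)) x"
    using pmf_of_set[OF assms(2,1)] pmf_of_set[OF assms(4,3)]
    by (cases x) (simp add: pmf_pair card_cartesian_product indicator_def)
qed

lemma sep_prob_eq:
  assumes "0 < p" "p \<le> n"
  shows "sep_prob n p A =
    real (card (separated_factorizations n p A)) / (real (stirling_c n p) * fact (n - 1))"
proof -
  let ?P = "perms_with_cycles n p" and ?F = "full_cycles_on {1..n}"
  have F: "full_cycles n = ?F" by (simp add: full_cycles_def full_cycles_on_def)
  have n: "{1..n} \<noteq> {}" using assms by auto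
  have finP: "finite ?P"
    unfolding perms_with_cycles_def using finite_permutations[of "{1..n}"]
    by (auto elim: rev_finite_subset)
  have neP: "?P \<noteq> {}"
    using exists_perm_with_cycles[of "{1..n}" p] assms by (auto simp: perms_with_cycles_def)
  have finF: "finite ?F" by (simp add: finite_full_cycles_on)
  have cardF: "card ?F = fact (n - 1)" using card_full_cycles_on[of "{1..n}"] n by simp
  then have neF: "?F \<noteq> {}" by auto
  let ?E = "{(u, v). separated n A (u \<circ> v)}"
  have "sep_prob n p A = measure_pmf.prob (pmf_of_set (?P \<times> ?F)) ?E"
    unfolding sep_prob_def F pair_pmf_of_set[OF finP neP finF neF] ..
  also have "\<dots> = real (card ((?P \<times> ?F) \<inter> ?E)) / real (card (?P \<times> ?F))"
    using finP neP finF neF by (intro measure_pmf_of_set) auto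
  also have "card (?P \<times> ?F) = stirling_c n p * fact (n - 1)"
    by (simp only: card_cartesian_product cardF stirling_c_def)
  also have "card ((?P \<times> ?F) \<inter> ?E) = card (separated_factorizations n p A)"
  proof (rule bij_betw_same_card)
    have sep: "separated n A w \<longleftrightarrow> separated_on {1..n} A w" for w
      by (simp add: separated_def separated_on_def)
    \<comment> \<open>The map and its inverse are given by the same formula, since \<open>v\<close>
      cancels against \<open>inv v\<close>.\<close>
    show "bij_betw (\<lambda>(u, v). (u \<circ> v, inv v)) ((?P \<times> ?F) \<inter> ?E) (separated_factorizations n p A)"
    proof (rule bij_betw_byWitness[where f' = "\<lambda>(w, v). (w \<circ> v, inv v)"])
      have v: "v \<circ> inv v = id" "inv v \<circ> v = id" "inv (inv v) = v" "inv v \<in> ?F"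
        "v permutes {1..n}" "inv v permutes {1..n}" if "v \<in> ?F" for v
        using full_cycles_on_permutes[OF that] inv_full_cycles_on[OF _ that]
        by (auto simp: permutes_inv_o permutes_inv_inv permutes_inv)
      have c: "u \<circ> v \<circ> inv v = u" "u \<circ> inv v \<circ> v = u" if "v \<in> ?F" for u :: "nat \<Rightarrow> nat" and v
        using v(1,2)[OF that] by (simp_all only: comp_assoc comp_id)
      show "\<forall>x\<in>(?P \<times> ?F) \<inter> ?E. (\<lambda>(w, v). (w \<circ> v, inv v)) ((\<lambda>(u, v). (u \<circ> v, inv v)) x) = x"
        using v c by auto
      show "\<forall>x\<in>separated_factorizations n p A.
          (\<lambda>(u, v). (u \<circ> v, inv v)) ((\<lambda>(w, v). (w \<circ> v, inv v)) x) = x"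
        using v c by (auto simp: separated_factorizations_def)
      show "(\<lambda>(u, v). (u \<circ> v, inv v)) ` ((?P \<times> ?F) \<inter> ?E) \<subseteq> separated_factorizations n p A"
        using v c by (auto simp: separated_factorizations_def perms_with_cycles_def
            separated_perms_def sep permutes_compose simp del: o_apply)
      show "(\<lambda>(w, v). (w \<circ> v, inv v)) ` separated_factorizations n p A \<subseteq> (?P \<times> ?F) \<inter> ?E"
        using v c by (auto simp: separated_factorizations_def perms_with_cycles_def
            separated_perms_def sep permutes_compose simp del: o_apply)
    qed
  qed
  finally show ?thesis by simp
qed

text \<open>The pairs \<open>(w, v)\<close> are grouped by the number of cycles of
  \<open>w \<circ> v\<close>. The bound is \<open>n + 1\<close> because, when there are no blocks,
  Stirling numbers with first index \<open>n + 1\<close> occur on the other side of the final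
  comparison.\<close>

lemma sum_full_cycle_sum:
  "(\<Sum>w\<in>separated_perms {1..n} A. full_cycle_sum y {1..n} w) =
    (\<Sum>p\<le>n + 1. real (card (separated_factorizations n p A)) * y ^ p)"
proof -
  let ?P = "separated_perms {1..n} A \<times> full_cycles_on {1..n}"
  let ?f = "\<lambda>(w, v). card (cycles_on {1..n} (w \<circ> v))"
  have fiber: "{x \<in> ?P. ?f x = p} = separated_factorizations n p A" for p
    by (auto simp: separated_factorizations_def)
  have "(\<Sum>w\<in>separated_perms {1..n} A. full_cycle_sum y {1..n} w) = (\<Sum>x\<in>?P. y ^ ?f x)"
    unfolding full_cycle_sum_def sum.cartesian_product
    by (intro sum.cong) (auto simp: cycle_weight_def)
  also have "\<dots> = (\<Sum>p\<le>n + 1. real (card {x \<in> ?P. ?f x = p}) * y ^ p)"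
  proof (rule sum_power_by_value)
    show "finite ?P" by (simp add: finite_separated_perms finite_full_cycles_on)
    show "?f x \<le> n + 1" for x
      using card_cycles_on_le[of "{1..n}"] by (auto simp: case_prod_unfold intro: le_SucI)
  qed
  finally show ?thesis unfolding fiber .
qed

section \<open>Comparison of coefficients in \<open>y\<close>\<close>

theorem theorem3p3:
  fixes n m k p :: nat and \<alpha> :: "nat list" and A :: "nat set list"
  assumes "is_composition \<alpha> m" and "length \<alpha> = k" and "m \<le> n"
    and "0 < p" and "p \<le> n"
    and "disjoint_tuple n \<alpha> A"
  shows "sep_prob n p A =
    fact (n - m) * (\<Prod>i<k. fact (\<alpha> ! i)) / real (stirling_c n p) *
    (\<Sum>r = 0..n - m.
       ((1 - real k) gchoose r) * ((real n + real k - 1) gchoose (n - m - r)) *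
       (real (stirling_c (n + 1 - k - r) p) / fact (n + 1 - k - r)))"
proof -
  define d where "d = n - m"
  define U where "U = \<Union>(set A)"
  define c where "c = (\<Prod>i<k. fact (\<alpha> ! i) :: real)"
  define a where "a r = ((1 - real k) gchoose r) * ((real n + real k - 1) gchoose (d - r))" for r
  \<comment> \<open>The subtraction is not truncated, since \<open>k \<le> m \<le> n\<close>;
    neither is \<open>N - r\<close> for \<open>r \<le> d\<close>, because
    \<open>d \<le> N\<close>.\<close>
  define N where "N = n + 1 - k"
  have lenA: "length A = k" using assms(2,6) by (simp add: disjoint_tuple_def)
  have cardA: "card (A ! i) = \<alpha> ! i" and subA: "A ! i \<subseteq> {1..n}" if "i < k" for i
    using assms(6) that lenA by (auto simp: disjoint_tuple_def)
  have pos: "0 < \<alpha> ! i" if "i < k" for i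
    using assms(1,2) that by (auto simp: is_composition_def)
  have blocks: "finite (A ! i) \<and> A ! i \<noteq> {}" if "i < length A" for i
    using that pos[of i] cardA[of i] lenA card_gt_0_iff by metis
  have disj: "A ! i \<inter> A ! j = {}" if "i < length A" "j < length A" "i \<noteq> j" for i j
    using assms(6) that by (auto simp: disjoint_tuple_def)
  have U: "U = (\<Union>i<k. A ! i)" unfolding U_def set_conv_nth lenA[symmetric] by auto
  have sumA: "(\<Sum>i<k. \<alpha> ! i) = m"
    using assms(1,2) by (simp add: is_composition_def sum_list_sum_nth atLeast0LessThan)
  have "card U = (\<Sum>i<k. card (A ! i))"
    unfolding U by (rule card_UN_disjoint) (use blocks disj lenA in auto)
  then have cardU: "card U = m" using sumA cardA by simp
  have subU: "U \<subseteq> {1..n}" using subA by (auto simp: U)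
  define D where "D = {1..n} - U"
  have UD: "U \<union> D = {1..n}" "D \<inter> U = {}" "finite D" using subU by (auto simp: D_def)
  have cardD: "card D = d"
    unfolding D_def d_def using subU cardU by (simp add: card_Diff_subset finite_subset)
  \<comment> \<open>Each of the \<open>k\<close> parts of the composition is at least
    \<open>1\<close>.\<close>
  have km: "k \<le> m"
    using sum_mono[of "{..<k}" "\<lambda>_. 1" "\<lambda>i. \<alpha> ! i"] pos sumA by (simp add: Suc_le_eq)
  have dN: "d \<le> N" and kn: "k \<le> n + 1" using km assms(3) by (auto simp: d_def N_def)
  have md: "real m + real d + real k - 1 = real n + real k - 1" using assms(3) by (simp add: d_def)
  let ?E = "neg_binomial_fps"
  define R where "R = separation_fps (real k) (real m) d"
  have W: "separated_weight {1..n} A = fps_const c * fps_X ^ k * R"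
    using separated_weight_eq[OF blocks disj UD(3) UD(2)[unfolded U_def]]
    by (simp add: U_def[symmetric] UD cardU cardD lenA R_def c_def cardA)
  \<comment> \<open>Two polynomials in \<open>y\<close> with the desired counts as coefficients are
    shown to agree at every real \<open>y\<close>.\<close>
  have "(\<Sum>p\<le>n + 1. real (card (separated_factorizations n p A)) * y ^ p) =
      (\<Sum>p\<le>n + 1. (fact (n - 1) * c * fact d *
        (\<Sum>r = 0..d. a r * (real (stirling_c (N - r) p) / fact (N - r)))) * y ^ p)" for y
  proof -
    have "(\<Sum>p\<le>n + 1. real (card (separated_factorizations n p A)) * y ^ p) =
        (\<Sum>w\<in>separated_perms {1..n} A. full_cycle_sum y {1..n} w)"
      by (rule sum_full_cycle_sum[symmetric])
    also have "\<dots> = (\<Sum>w\<in>separated_perms {1..n} A.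
        fact (n - 1) * (?E y * cycle_weight cycle_fps {1..n} w) $ (n + 1))"
      using full_cycle_sum_eq[of "{1..n}" _ y] assms(4,5)
      by (intro sum.cong) (auto simp: separated_perms_def)
    also have "\<dots> = fact (n - 1) * (?E y * separated_weight {1..n} A) $ (n + 1)"
      by (simp add: separated_weight_def sum_distrib_left fps_sum_nth)
    also have "?E y * separated_weight {1..n} A = fps_X ^ k * (fps_const c * (R * ?E y))"
      unfolding W by (simp only: ac_simps)
    \<comment> \<open>The factor \<open>X^k\<close> lowers the relevant degree from
      \<open>n + 1\<close> to \<open>N\<close>.\<close>
    also have "(fps_X ^ k * (fps_const c * (R * ?E y))) $ (n + 1) = c * (R * ?E y) $ N"
      using kn by (simp add: fps_X_power_mult_nth N_def)
    also have "(R * ?E y) $ N = (\<Sum>r = 0..N. R $ r * ?E y $ (N - r))"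
      by (rule fps_mult_nth)
    \<comment> \<open>\<open>R\<close> has no terms of degree above \<open>d\<close>, and
      \<open>d \<le> N\<close>.\<close>
    also have "\<dots> = (\<Sum>r = 0..d. R $ r * ?E y $ (N - r))"
      using dN by (intro sum.mono_neutral_right) (auto simp: R_def separation_fps_def)
    also have "\<dots> = (\<Sum>r = 0..d. fact d * a r *
        (\<Sum>p\<le>n + 1. real (stirling_c (N - r) p) / fact (N - r) * y ^ p))"
    proof (rule sum.cong[OF refl])
      fix r assume "r \<in> {0..d}"
      then have "R $ r = fact d * a r"
        by (simp add: R_def separation_fps_def a_def md)
      moreover have "?E y $ (N - r) = (\<Sum>p\<le>n + 1. real (stirling_c (N - r) p) / fact (N - r) * y ^ p)"
      proof -
        have "N - r \<le> n + 1" by (simp add: N_def)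
        from pochhammer_stirling_c[OF this, of y] show ?thesis
          by (simp only: neg_binomial_fps_def fps_nth_Abs_fps sum_divide_distrib times_divide_eq_left)
      qed
      ultimately show "R $ r * ?E y $ (N - r) = fact d * a r *
          (\<Sum>p\<le>n + 1. real (stirling_c (N - r) p) / fact (N - r) * y ^ p)" by (simp only:)
    qed
    also have "fact (n - 1) * (c * \<dots>) =
        (\<Sum>r = 0..d. \<Sum>p\<le>n + 1. fact (n - 1) * c * fact d *
          (a r * (real (stirling_c (N - r) p) / fact (N - r))) * y ^ p)"
      unfolding sum_distrib_left by (intro sum.cong refl) (simp only: ac_simps)
    also have "\<dots> = (\<Sum>p\<le>n + 1. (fact (n - 1) * c * fact d *
        (\<Sum>r = 0..d. a r * (real (stirling_c (N - r) p) / fact (N - r)))) * y ^ p)"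
      by (subst sum.swap) (simp only: sum_distrib_left sum_distrib_right)
    finally show ?thesis .
  qed
  \<comment> \<open>Real polynomial functions that agree everywhere have equal coefficients.\<close>
  then have "\<forall>p\<le>n + 1. real (card (separated_factorizations n p A)) = fact (n - 1) * c * fact d *
      (\<Sum>r = 0..d. a r * (real (stirling_c (N - r) p) / fact (N - r)))"
    by (intro polyfun_eq_coeffs[THEN iffD1] allI)
  then have "real (card (separated_factorizations n p A)) = fact (n - 1) * c * fact d *
      (\<Sum>r = 0..d. a r * (real (stirling_c (N - r) p) / fact (N - r)))"
    using assms(5) by (meson le_add1 order_trans)
  then have "sep_prob n p A = fact d * c / real (stirling_c n p) *
      (\<Sum>r = 0..d. a r * (real (stirling_c (N - r) p) / fact (N - r)))"
    unfolding sep_prob_eq[OF assms(4,5)] by simp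
  then show ?thesis
    unfolding a_def c_def N_def d_def .
qed

end
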